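(* Let $B$ be a transcendence basis of $\mathbb{R}/\mathbb{Q}$ containing $\pi$, and put $t=\pi^{-1}$ and $k=\mathbb{Q}(B\setminus\{\pi\})$. Let $\mathcal{O}$ be the integral closure in $\mathbb{C}$ of the local ring $$D=k[t]_{(t)}=\left\{\frac{f(t)}{g(t)}: f,g\in k[T],\ g(0)\neq 0\right\}.$$ Then the set $$P=\{0\}\cup\bigcup_{n\in\mathbb{Z}}t^{-n}(\mathbb{A}_{>0}+t\mathcal{O})$$ is a positive cone defining a directed ring order on $\mathbb{C}$. It contains $1$ and is closed under inversion of nonzero elements. For every $z\in\mathbb{C}$ there is an integer $N\ge 1$ such that $\pi^N+z\in P\setminus\{0\}$ and $\pi^N-z\in P\setminus\{0\}$. Moreover, $P\cap\overline{\mathbb{Q}}=\mathbb{A}_{\ge 0}$.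
   Context: $\overline{\mathbb{Q}}\subseteq\mathbb{C}$ is the field of all algebraic numbers and $\mathbb{A}=\overline{\mathbb{Q}}\cap\mathbb{R}$ is the field of real algebraic numbers with its usual order; $\mathbb{A}_{>0}$ and $\mathbb{A}_{\ge0}$ are its positive and nonnegative elements. In the definition of $D$, $T$ is an indeterminate, and $k[t]_{(t)}$ is the localization of $k[t]$ at the maximal ideal $(t)$. Here $\mathbb{A}_{>0}+t\mathcal{O}=\{a+tr: a\in\mathbb{A}_{>0}, r\in\mathcal{O}\}$. A positive cone in a field $E$ is a subset $P\subseteq E$ with $P+P\subseteq P$, $PP\subseteq P$ and $P\cap(-P)=\{0\}$. It defines a ring order on $E$ by $x\preceq y$ iff $y-x\in P$. The order is directed if every pair of elements has a common upper bound and a common lower bound; equivalently, $P-P=E$. *)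

theory Defs
  imports
    Complex_Main
    "HOL-Computational_Algebra.Polynomial"
    "HOL-Library.Poly_Mapping"
begin

section \<open>Field extensions inside a fixed field\<close>

definition is_subfield :: "'a::field set \<Rightarrow> bool" where
  "is_subfield F \<longleftrightarrow> 0 \<in> F \<and> 1 \<in> F \<and>
     (\<forall>x\<in>F. \<forall>y\<in>F. x - y \<in> F \<and> x * y \<in> F) \<and> (\<forall>x\<in>F. inverse x \<in> F)"

definition adjoin :: "'a::field set \<Rightarrow> 'a set \<Rightarrow> 'a set" where
  "adjoin K S = is_subfield hull (K \<union> S)"

text \<open>The analogue, for an arbitrary field of coefficients, of the library predicate
  \<^const>\<open>algebraic\<close>.\<close>

definition algebraic_over :: "'a::field set \<Rightarrow> 'a \<Rightarrow> bool" where
  "algebraic_over K x \<longleftrightarrow> (\<exists>p. (\<forall>i. coeff p i \<in> K) \<and> p \<noteq> 0 \<and> poly p x = 0)"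

text \<open>A multivariate polynomial with one indeterminate for each element of \<^typ>\<open>'a\<close> is a finitely
  supported map from exponent vectors to coefficients. It is evaluated by substituting for the
  indeterminate attached to \<open>b\<close> the element \<open>b\<close> itself.\<close>

definition eval_mpoly :: "(('a::comm_ring_1 \<Rightarrow>\<^sub>0 nat) \<Rightarrow>\<^sub>0 'a) \<Rightarrow> 'a" where
  "eval_mpoly p = (\<Sum>m\<in>Poly_Mapping.keys p.
     Poly_Mapping.lookup p m * (\<Prod>b\<in>Poly_Mapping.keys m. b ^ Poly_Mapping.lookup m b))"

definition algebraically_independent :: "'a::field set \<Rightarrow> 'a set \<Rightarrow> bool" where
  "algebraically_independent K B \<longleftrightarrow>
     (\<forall>p :: ('a \<Rightarrow>\<^sub>0 nat) \<Rightarrow>\<^sub>0 'a.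
        (\<forall>m. Poly_Mapping.lookup p m \<in> K) \<longrightarrow>
        (\<forall>m\<in>Poly_Mapping.keys p. Poly_Mapping.keys m \<subseteq> B) \<longrightarrow>
        eval_mpoly p = 0 \<longrightarrow> p = 0)"

text \<open>Transcendence bases of the field of all elements of \<^typ>\<open>'a\<close> over \<open>K\<close>.\<close>

definition transcendence_basis :: "'a::field set \<Rightarrow> 'a set \<Rightarrow> bool" where
  "transcendence_basis K B \<longleftrightarrow>
     algebraically_independent K B \<and> (\<forall>x. algebraic_over (adjoin K B) x)"


section \<open>Localization and integral closure\<close>

text \<open>The local ring $k[t]_{(t)}$, for \<open>t\<close> transcendental over the field \<open>k\<close>;
  then \<open>poly g 0 \<noteq> 0\<close> implies \<open>poly g t \<noteq> 0\<close>, so no division by zero occurs.\<close>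

definition local_ring :: "'a::field set \<Rightarrow> 'a \<Rightarrow> 'a set" where
  "local_ring k t = {poly f t / poly g t | f g.
     (\<forall>i. coeff f i \<in> k) \<and> (\<forall>i. coeff g i \<in> k) \<and> poly g 0 \<noteq> 0}"

text \<open>The integral closure of \<open>A\<close> in the ring of all elements of \<^typ>\<open>'a\<close>.\<close>

definition integral_closure :: "'a::comm_ring_1 set \<Rightarrow> 'a set" where
  "integral_closure A = {z. \<exists>p. lead_coeff p = 1 \<and> (\<forall>i. coeff p i \<in> A) \<and> poly p z = 0}"


section \<open>Algebraic numbers\<close>

definition Qbar :: "complex set" where
  "Qbar = {z. algebraic z}"

text \<open>The positive and the nonnegative elements of the ordered field \<open>Qbar \<inter> \<real>\<close>, as subsets of the
  complex plane.\<close>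

definition real_algebraic_pos :: "complex set" where
  "real_algebraic_pos = Qbar \<inter> complex_of_real ` {0<..}"

definition real_algebraic_nonneg :: "complex set" where
  "real_algebraic_nonneg = Qbar \<inter> complex_of_real ` {0..}"


section \<open>Positive cones and ring orders\<close>

definition positive_cone :: "'a::field set \<Rightarrow> bool" where
  "positive_cone P \<longleftrightarrow>
     (\<forall>x\<in>P. \<forall>y\<in>P. x + y \<in> P) \<and> (\<forall>x\<in>P. \<forall>y\<in>P. x * y \<in> P) \<and> P \<inter> uminus ` P = {0}"

definition cone_le :: "'a::field set \<Rightarrow> 'a \<Rightarrow> 'a \<Rightarrow> bool" where
  "cone_le P x y \<longleftrightarrow> y - x \<in> P"

text \<open>Ring orders are partial orders; they need not be total.\<close>

definition ring_order :: "('a::ring \<Rightarrow> 'a \<Rightarrow> bool) \<Rightarrow> bool" where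
  "ring_order le \<longleftrightarrow> reflp le \<and> antisymp le \<and> transp le \<and>
     (\<forall>x y z. le x y \<longrightarrow> le (x + z) (y + z)) \<and>
     (\<forall>x y. le 0 x \<longrightarrow> le 0 y \<longrightarrow> le 0 (x * y))"

definition directed_order :: "('a \<Rightarrow> 'a \<Rightarrow> bool) \<Rightarrow> bool" where
  "directed_order le \<longleftrightarrow> (\<forall>x y. (\<exists>u. le x u \<and> le y u) \<and> (\<exists>l. le l x \<and> le l y))"

end

theory Submission
  imports Defs "Jordan_Normal_Form.Char_Poly"
begin

text \<open>
  The integral closure \<open>\<O>\<close> of the local ring \<open>D\<close> behaves like a ring of power series in \<open>t\<close>, and
  \<open>P\<close> consists of the elements with a positive real algebraic leading coefficient. Four facts make
  this work.

  \<^item> \<open>\<O>\<close> is a ring (lemma \<open>integral_closure_subring\<close>).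
  \<^item> \<open>t\<close> lies in the Jacobson radical of \<open>\<O>\<close>: every \<open>1 + t * r\<close> is a unit. This is immediate for \<open>D\<close>,
    where \<open>t\<close> generates the maximal ideal, and it passes to integral closures (lemma
    \<open>jacobson_radical_integral_closure\<close>).
  \<^item> \<open>\<O>\<close> contains all algebraic numbers, as \<open>D\<close> contains the rational numbers.
  \<^item> Every complex number becomes an element of \<open>\<O>\<close> after multiplication by a power of \<open>t\<close> (lemma
    \<open>scaled_integral_over_local_ring\<close>), because the complex numbers are algebraic over the field of
    fractions \<open>D[1/t]\<close> of \<open>D\<close>.

  From the second fact, an element \<open>a + t * r\<close> with \<open>a\<close> a positive algebraic number equals
  \<open>a * (1 + t * (r / a))\<close>, so it is a unit of \<open>\<O>\<close>, and its inverse again has the form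
  \<open>a' + t * r'\<close>. Such elements are closed under sums, products and inverses, and they absorb any
  perturbation from \<open>t\<O>\<close>; in a sum of two of their multiples by powers of \<open>t\<close> the lower power of
  \<open>t\<close> wins. Hence \<open>P - {0}\<close> is closed under sums, which excludes \<open>x\<close> and \<open>- x\<close> both being in
  \<open>P - {0}\<close>. If \<open>t ^ N * z\<close> is in \<open>\<O>\<close>, then
  \<open>\<pi> ^ (N + 1) + z = t ^ (- (N + 1)) * (1 + t * (t ^ N * z))\<close> is in \<open>P\<close>, which gives domination by
  powers of \<open>\<pi>\<close> and directedness. Finally, a nonzero algebraic number is a unit of \<open>\<O>\<close>, hence not in
  \<open>t\<O>\<close>; so an algebraic number in \<open>P\<close> has leading exponent \<open>0\<close> and equals its leading coefficient.
  All of this is carried out for a ring \<open>R\<close> with an element \<open>t\<close> of its Jacobson radical in the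
  locale \<open>infinitesimal_cone\<close>.

  Transcendence of \<open>\<pi>\<close> over \<open>k\<close> makes \<open>D\<close> a local ring in which \<open>t\<close> is not invertible: a polynomial
  over \<open>k\<close> with nonzero constant coefficient does not vanish at \<open>t\<close>. It is derived from algebraic
  independence of the basis in lemma \<open>algebraically_independent_imp_transcendental\<close>.
\<close>

section \<open>Subrings and their polynomials\<close>

definition is_subring :: "'a::comm_ring_1 set \<Rightarrow> bool" where
  "is_subring A \<longleftrightarrow> 1 \<in> A \<and> (\<forall>x\<in>A. \<forall>y\<in>A. x - y \<in> A \<and> x * y \<in> A)"

lemma is_subringD:
  assumes "is_subring A"
  shows subring_one: "1 \<in> A"
    and subring_diff: "\<And>x y. x \<in> A \<Longrightarrow> y \<in> A \<Longrightarrow> x - y \<in> A"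
    and subring_mult: "\<And>x y. x \<in> A \<Longrightarrow> y \<in> A \<Longrightarrow> x * y \<in> A"
    and subring_zero: "0 \<in> A"
    and subring_uminus: "\<And>x. x \<in> A \<Longrightarrow> - x \<in> A"
    and subring_add: "\<And>x y. x \<in> A \<Longrightarrow> y \<in> A \<Longrightarrow> x + y \<in> A"
proof -
  show one: "1 \<in> A" using assms by (simp add: is_subring_def)
  show diff: "x - y \<in> A" if "x \<in> A" "y \<in> A" for x y
    using assms that by (simp add: is_subring_def)
  show "x * y \<in> A" if "x \<in> A" "y \<in> A" for x y
    using assms that by (simp add: is_subring_def)
  show zero: "0 \<in> A" using diff[OF one one] by simp
  show um: "- x \<in> A" if "x \<in> A" for x using diff[OF zero that] by simp
  show "x + y \<in> A" if "x \<in> A" "y \<in> A" for x y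
    using diff[OF that(1) um[OF that(2)]] by simp
qed

lemma subring_sum:
  assumes "is_subring A" "\<And>i. i \<in> I \<Longrightarrow> f i \<in> A"
  shows "(\<Sum>i\<in>I. f i) \<in> A"
  using assms(2) by (induction I rule: infinite_finite_induct)
    (auto intro: is_subringD[OF assms(1)])

lemma subring_prod:
  assumes "is_subring A" "\<And>i. i \<in> I \<Longrightarrow> f i \<in> A"
  shows "(\<Prod>i\<in>I. f i) \<in> A"
  using assms(2) by (induction I rule: infinite_finite_induct)
    (auto intro: is_subringD[OF assms(1)])

lemma subring_power: "is_subring A \<Longrightarrow> x \<in> A \<Longrightarrow> x ^ n \<in> A"
  by (induction n) (auto intro: is_subringD)

lemma subfield_imp_subring: "is_subfield F \<Longrightarrow> is_subring F"
  by (simp add: is_subfield_def is_subring_def)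

definition polys_over :: "'a::comm_ring_1 set \<Rightarrow> 'a poly set" where
  "polys_over A = {p. \<forall>i. coeff p i \<in> A}"

lemma polys_over_subring:
  assumes A: "is_subring A"
  shows "is_subring (polys_over A)"
  unfolding is_subring_def polys_over_def
  by (auto simp: coeff_mult coeff_1 intro!: subring_sum[OF A] is_subringD[OF A])

lemma polys_over_pCons_iff: "pCons a p \<in> polys_over A \<longleftrightarrow> a \<in> A \<and> p \<in> polys_over A"
  by (auto simp: polys_over_def coeff_pCons split: nat.splits)

lemma polys_over_0: "is_subring A \<Longrightarrow> 0 \<in> polys_over A"
  by (simp add: polys_over_def is_subringD)

lemma polys_over_pcompose:
  assumes A: "is_subring A" and p: "p \<in> polys_over A" and q: "q \<in> polys_over A"
  shows "pcompose p q \<in> polys_over A"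
  using p
proof (induction p)
  case (pCons a p)
  then show ?case
    by (auto simp: pcompose_pCons polys_over_pCons_iff polys_over_0[OF A]
      intro!: is_subringD[OF polys_over_subring[OF A]] q)
qed (simp add: polys_over_0[OF A])

lemma polys_over_reflect:
  assumes A: "is_subring A" and p: "p \<in> polys_over A"
  shows "reflect_poly p \<in> polys_over A"
  using p is_subringD[OF A] by (simp add: polys_over_def coeff_reflect_poly)

section \<open>Integral closure\<close>

lemma integral_closureI:
  "lead_coeff p = 1 \<Longrightarrow> p \<in> polys_over A \<Longrightarrow> poly p z = 0 \<Longrightarrow> z \<in> integral_closure A"
  by (auto simp: integral_closure_def polys_over_def)

lemma integral_closureE:
  assumes "z \<in> integral_closure A"
  obtains p where "lead_coeff p = 1" "p \<in> polys_over A" "poly p z = 0"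
  using assms by (auto simp: integral_closure_def polys_over_def)

text \<open>By the Leibniz formula, the determinant is a polynomial in the entries with coefficients
  \<open>1\<close> and \<open>- 1\<close>.\<close>

lemma det_in_subring:
  assumes S: "is_subring S" and M: "M \<in> carrier_mat n n"
    and e: "\<And>i j. i < n \<Longrightarrow> j < n \<Longrightarrow> M $$ (i, j) \<in> S"
  shows "det M \<in> S"
proof -
  have "signof p \<in> S" for p :: "nat \<Rightarrow> nat"
    using is_subringD[OF S] by (auto simp: sign_def)
  moreover have "(\<Prod>i = 0..<n. M $$ (i, p i)) \<in> S" if "p permutes {0..<n}" for p
    using permutes_in_image[OF that] by (intro subring_prod[OF S] e) auto
  ultimately show ?thesis
    unfolding det_def'[OF M] by (intro subring_sum[OF S] is_subringD(3)[OF S]) auto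
qed

lemma char_poly_over:
  assumes A: "is_subring A" and M: "M \<in> carrier_mat n n"
    and e: "\<And>i j. i < n \<Longrightarrow> j < n \<Longrightarrow> M $$ (i, j) \<in> A"
  shows "char_poly M \<in> polys_over A"
  unfolding char_poly_def
proof (rule det_in_subring[OF polys_over_subring[OF A] char_poly_matrix_closed[OF M]])
  fix i j assume "i < n" "j < n"
  then show "char_poly_matrix M $$ (i, j) \<in> polys_over A"
    using M e is_subringD[OF A]
    by (auto simp: char_poly_matrix_def polys_over_pCons_iff polys_over_0[OF A] one_pCons)
qed

definition span_over :: "'a::comm_ring_1 set \<Rightarrow> 'i set \<Rightarrow> ('i \<Rightarrow> 'a) \<Rightarrow> 'a set" where
  "span_over A I v = {\<Sum>i\<in>I. c i * v i | c. \<forall>i\<in>I. c i \<in> A}"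

lemma span_over_base:
  assumes A: "is_subring A" and I: "finite I" "i \<in> I"
  shows "v i \<in> span_over A I v"
proof -
  have "v i = (\<Sum>j\<in>I. (if j = i then 1 else 0) * v j)"
    using I by (simp add: if_distrib[of "\<lambda>a. a * _"] sum.delta cong: if_cong)
  then show ?thesis
    unfolding span_over_def using is_subringD[OF A] by (auto intro!: exI[of _ "\<lambda>j. if j = i then 1 else 0"])
qed

lemma span_over_diff:
  assumes A: "is_subring A" and xy: "x \<in> span_over A I v" "y \<in> span_over A I v"
  shows "x - y \<in> span_over A I v"
proof -
  obtain c d where "x = (\<Sum>i\<in>I. c i * v i)" "y = (\<Sum>i\<in>I. d i * v i)"
    "\<forall>i\<in>I. c i \<in> A" "\<forall>i\<in>I. d i \<in> A"
    using xy unfolding span_over_def by auto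
  then show ?thesis
    unfolding span_over_def using is_subringD[OF A]
    by (auto intro!: exI[of _ "\<lambda>i. c i - d i"] simp: algebra_simps sum_subtractf)
qed

lemma span_over_scale:
  assumes A: "is_subring A" and x: "x \<in> span_over A I v" and a: "a \<in> A"
  shows "a * x \<in> span_over A I v"
proof -
  obtain c where "x = (\<Sum>i\<in>I. c i * v i)" "\<forall>i\<in>I. c i \<in> A"
    using x unfolding span_over_def by auto
  then show ?thesis
    unfolding span_over_def using is_subringD[OF A] a
    by (auto intro!: exI[of _ "\<lambda>i. a * c i"] simp: algebra_simps sum_distrib_left)
qed

lemma span_over_sum:
  assumes A: "is_subring A" and "\<And>j. j \<in> J \<Longrightarrow> f j \<in> span_over A I v"
  shows "(\<Sum>j\<in>J. f j) \<in> span_over A I v"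
proof -
  have z: "0 \<in> span_over A I v"
    unfolding span_over_def using is_subringD[OF A] by (auto intro!: exI[of _ "\<lambda>i. 0"])
  have add: "x + y \<in> span_over A I v" if "x \<in> span_over A I v" "y \<in> span_over A I v" for x y
    using span_over_diff[OF A that(1) span_over_diff[OF A z that(2)]] by simp
  show ?thesis
    using assms(2) by (induction J rule: infinite_finite_induct) (auto intro: z add)
qed

lemma span_over_stable:
  assumes A: "is_subring A" and st: "\<And>i. i \<in> I \<Longrightarrow> x * v i \<in> span_over A I v"
    and m: "m \<in> span_over A I v"
  shows "x * m \<in> span_over A I v"
proof -
  obtain c where c: "m = (\<Sum>i\<in>I. c i * v i)" "\<forall>i\<in>I. c i \<in> A"
    using m unfolding span_over_def by auto
  have "x * m = (\<Sum>i\<in>I. c i * (x * v i))"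
    by (simp add: c sum_distrib_left algebra_simps)
  also have "\<dots> \<in> span_over A I v"
    by (rule span_over_sum[OF A], rule span_over_scale[OF A st]) (use c in auto)
  finally show ?thesis .
qed

text \<open>The determinant trick: writing \<open>z * v i\<close> in terms of the generators gives a matrix over \<open>A\<close>
  that has \<open>z\<close> as an eigenvalue with the vector of generators as eigenvector, so \<open>z\<close> is a root of
  its characteristic polynomial, which is monic with coefficients in \<open>A\<close>.\<close>

lemma integral_if_stable_span:
  fixes z :: "'a::field"
  assumes A: "is_subring A" and I: "finite I"
    and st: "\<And>i. i \<in> I \<Longrightarrow> z * v i \<in> span_over A I v"
    and nz: "k0 \<in> I" "v k0 \<noteq> 0"
  shows "z \<in> integral_closure A"
proof -
  define n where "n = card I"
  obtain h where h: "bij_betw h {0..<n} I"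
    using ex_bij_betw_nat_finite[OF I] n_def by blast
  have "\<exists>c. (\<forall>i\<in>I. c i \<in> A) \<and> z * v k = (\<Sum>i\<in>I. c i * v i)" if "k \<in> I" for k
    using st[OF that] unfolding span_over_def by auto
  then obtain c where cA: "\<And>k i. k \<in> I \<Longrightarrow> i \<in> I \<Longrightarrow> c k i \<in> A"
    and c: "\<And>k. k \<in> I \<Longrightarrow> z * v k = (\<Sum>i\<in>I. c k i * v i)"
    by metis
  have hI: "h i \<in> I" if "i < n" for i using h that by (auto simp: bij_betw_def)
  define M where "M = mat n n (\<lambda>(i, j). c (h i) (h j))"
  define w where "w = vec n (\<lambda>i. v (h i))"
  have M: "M \<in> carrier_mat n n" by (simp add: M_def)
  have w: "w \<in> carrier_vec n" by (simp add: w_def)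
  obtain k1 where k1: "k1 < n" "h k1 = k0"
    using nz(1) h by (metis atLeastLessThan_iff bij_betw_def imageE)
  have "M *\<^sub>v w = z \<cdot>\<^sub>v w"
  proof (rule eq_vecI)
    fix i assume "i < dim_vec (z \<cdot>\<^sub>v w)"
    then have i: "i < n" by (simp add: w_def)
    have "(M *\<^sub>v w) $ i = (\<Sum>j\<in>{0..<n}. c (h i) (h j) * v (h j))"
      using i by (simp add: M_def w_def scalar_prod_def)
    also have "\<dots> = (\<Sum>j\<in>I. c (h i) j * v j)"
      by (rule sum.reindex_bij_betw[OF h])
    also have "\<dots> = z * v (h i)" using c[OF hI[OF i]] by simp
    finally show "(M *\<^sub>v w) $ i = (z \<cdot>\<^sub>v w) $ i" using i by (simp add: w_def)
  qed (simp add: M_def w_def)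
  moreover have "w \<noteq> 0\<^sub>v n"
  proof
    assume "w = 0\<^sub>v n"
    then have "w $ k1 = 0" using k1 by simp
    then show False using k1 nz by (simp add: w_def)
  qed
  ultimately have "eigenvalue M z"
    unfolding eigenvalue_def eigenvector_def using M w by auto
  then have "poly (char_poly M) z = 0"
    using eigenvalue_root_char_poly[OF M] by blast
  moreover have "char_poly M \<in> polys_over A"
    by (rule char_poly_over[OF A M]) (simp add: M_def cA hI)
  ultimately show ?thesis
    using degree_monic_char_poly[OF M] by (intro integral_closureI[of "char_poly M"]) auto
qed

lemma base_subset_integral_closure:
  assumes A: "is_subring A"
  shows "A \<subseteq> integral_closure A"
proof
  fix a assume "a \<in> A"
  then show "a \<in> integral_closure A"
    using is_subringD[OF A]
    by (intro integral_closureI[of "[:- a, 1:]"]) (auto simp: polys_over_pCons_iff polys_over_0[OF A])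
qed

lemma integral_power_reduction:
  assumes A: "is_subring A" and p: "lead_coeff p = 1" "p \<in> polys_over A" "poly p x = 0"
  shows "x ^ degree p = (\<Sum>k<degree p. - coeff p k * x ^ k)"
proof -
  have "0 = (\<Sum>k\<le>degree p. coeff p k * x ^ k)" using p(3) by (simp add: poly_altdef)
  also have "\<dots> = (\<Sum>k<degree p. coeff p k * x ^ k) + x ^ degree p"
    using p(1) by (simp add: lessThan_Suc_atMost[symmetric])
  finally show ?thesis by (simp add: sum_negf eq_neg_iff_add_eq_0 add.commute)
qed

lemma monic_root_degree:
  "lead_coeff p = (1::'a::field) \<Longrightarrow> poly p x = 0 \<Longrightarrow> degree p > 0"
  by (rule ccontr) (auto elim!: degree_eq_zeroE)

text \<open>If \<open>x\<close> and \<open>y\<close> are roots of monic polynomials of degrees \<open>n\<close> and \<open>m\<close>, then the span of the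
  monomials \<open>x ^ i * y ^ j\<close> with \<open>i < n\<close> and \<open>j < m\<close> is stable under multiplication by \<open>x\<close> and by \<open>y\<close>,
  hence under multiplication by \<open>x - y\<close> and \<open>x * y\<close>.\<close>

theorem integral_closure_subring:
  fixes A :: "'a::field set"
  assumes A: "is_subring A"
  shows "is_subring (integral_closure A)"
proof -
  have "x - y \<in> integral_closure A \<and> x * y \<in> integral_closure A"
    if xy: "x \<in> integral_closure A" "y \<in> integral_closure A" for x y
  proof -
    obtain p where p: "lead_coeff p = 1" "p \<in> polys_over A" "poly p x = 0"
      using integral_closureE[OF xy(1)] .
    obtain q where q: "lead_coeff q = 1" "q \<in> polys_over A" "poly q y = 0"
      using integral_closureE[OF xy(2)] .
    define n where "n = degree p"
    define m where "m = degree q"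
    define I where "I = {..<n} \<times> {..<m}"
    define v where "v = (\<lambda>(i, j). x ^ i * y ^ j)"
    have pos: "n > 0" "m > 0"
      unfolding n_def m_def using p q by (auto intro: monic_root_degree)
    have I: "finite I" "(0, 0) \<in> I" "v (0, 0) \<noteq> 0" using pos by (auto simp: I_def v_def)
    have base: "x ^ i * y ^ j \<in> span_over A I v" if "i < n" "j < m" for i j
      using span_over_base[OF A I(1), of "(i, j)" v] that by (simp add: I_def v_def)
    have "x * v ij \<in> span_over A I v" if ij_in: "ij \<in> I" for ij
    proof -
      obtain i j where ij: "ij = (i, j)" "i < n" "j < m" using ij_in by (auto simp: I_def)
      show ?thesis
      proof (cases "Suc i = n")
        case True
        have "x * v ij = x ^ n * y ^ j" by (simp add: ij v_def flip: True)
        also have "\<dots> = (\<Sum>k<n. - coeff p k * (x ^ k * y ^ j))"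
          unfolding n_def integral_power_reduction[OF A p] by (simp add: sum_distrib_right mult.assoc)
        also have "\<dots> \<in> span_over A I v"
          using p(2) ij is_subringD[OF A]
          by (intro span_over_sum[OF A] span_over_scale[OF A] base) (auto simp: polys_over_def)
        finally show ?thesis .
      next
        case False
        then show ?thesis using ij base[of "Suc i" j] by (simp add: v_def mult.assoc)
      qed
    qed
    note x_stable = span_over_stable[OF A this]
    have "y * v ij \<in> span_over A I v" if ij_in: "ij \<in> I" for ij
    proof -
      obtain i j where ij: "ij = (i, j)" "i < n" "j < m" using ij_in by (auto simp: I_def)
      show ?thesis
      proof (cases "Suc j = m")
        case True
        have "y * v ij = x ^ i * y ^ m" by (simp add: ij v_def flip: True)
        also have "\<dots> = (\<Sum>k<m. - coeff q k * (x ^ i * y ^ k))"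
          unfolding m_def integral_power_reduction[OF A q]
            by (simp add: sum_distrib_left mult.left_commute)
        also have "\<dots> \<in> span_over A I v"
          using q(2) ij is_subringD[OF A]
          by (intro span_over_sum[OF A] span_over_scale[OF A] base) (auto simp: polys_over_def)
        finally show ?thesis .
      next
        case False
        then show ?thesis using ij base[of i "Suc j"] by (simp add: v_def algebra_simps)
      qed
    qed
    note y_stable = span_over_stable[OF A this]
    have v: "v ij \<in> span_over A I v" if "ij \<in> I" for ij
      using span_over_base[OF A I(1) that] .
    show ?thesis
    proof
      show "x - y \<in> integral_closure A"
        by (rule integral_if_stable_span[where v = v, OF A I(1) _ I(2,3)])
          (auto simp: left_diff_distrib intro!: span_over_diff[OF A] x_stable y_stable v)
      show "x * y \<in> integral_closure A"
        by (rule integral_if_stable_span[where v = v, OF A I(1) _ I(2,3)])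
          (auto simp: mult.assoc intro!: x_stable y_stable v)
    qed
  qed
  then show ?thesis
    using base_subset_integral_closure[OF A] is_subringD[OF A] unfolding is_subring_def by blast
qed

lemma integral_closure_mono: "A \<subseteq> A' \<Longrightarrow> integral_closure A \<subseteq> integral_closure A'"
  unfolding integral_closure_def by blast

text \<open>The inverse of \<open>u\<close> is a root of the reversed polynomial, whose leading coefficient is the
  constant coefficient of \<open>p\<close>; that coefficient being a unit, the reversed polynomial can be made
  monic.\<close>

lemma integral_inverse:
  fixes u :: "'a::field"
  assumes A: "is_subring A" and p: "lead_coeff p = 1" "p \<in> polys_over A" "poly p u = 0"
    and c: "coeff p 0 \<noteq> 0" "inverse (coeff p 0) \<in> A"
  shows "u \<noteq> 0 \<and> inverse u \<in> integral_closure A"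
proof
  show u: "u \<noteq> 0" using p(3) c(1) by (auto simp: poly_0_coeff_0)
  define q where "q = Polynomial.smult (inverse (coeff p 0)) (reflect_poly p)"
  show "inverse u \<in> integral_closure A"
  proof (rule integral_closureI)
    show "lead_coeff q = 1" using c by (simp add: q_def coeff_reflect_poly)
    show "q \<in> polys_over A"
      using polys_over_reflect[OF A p(2)] c is_subringD[OF A] by (auto simp: q_def polys_over_def)
    show "poly q (inverse u) = 0"
      using u p(3) by (simp add: q_def poly_reflect_poly_nz)
  qed
qed

text \<open>The polynomial \<open>c ^ n * p(X / c)\<close> with \<open>n = degree p\<close>, written without division; it
  vanishes at \<open>c * x\<close> whenever \<open>x\<close> is a root of \<open>p\<close>.\<close>

definition scale_roots :: "'a::comm_ring_1 \<Rightarrow> 'a poly \<Rightarrow> 'a poly" where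
  "scale_roots c p = (\<Sum>i\<le>degree p. monom (c ^ (degree p - i) * coeff p i) i)"

lemma coeff_scale_roots:
  "coeff (scale_roots c p) i = (if i \<le> degree p then c ^ (degree p - i) * coeff p i else 0)"
  by (simp add: scale_roots_def coeff_sum)

lemma lead_coeff_scale_roots:
  assumes "lead_coeff p = (1::'a::field)"
  shows "degree (scale_roots c p) = degree p" "lead_coeff (scale_roots c p) = 1"
proof -
  show *: "degree (scale_roots c p) = degree p"
  proof (rule antisym)
    show "degree (scale_roots c p) \<le> degree p"
      by (rule degree_le) (simp add: coeff_scale_roots)
    show "degree p \<le> degree (scale_roots c p)"
      by (rule le_degree) (use assms in \<open>simp add: coeff_scale_roots\<close>)
  qed
  show "lead_coeff (scale_roots c p) = 1"
    unfolding * using assms by (simp add: coeff_scale_roots)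
qed

lemma poly_scale_roots: "poly (scale_roots c p) (c * x) = c ^ degree p * poly p x"
proof -
  have "poly (scale_roots c p) (c * x) = (\<Sum>i\<le>degree p. c ^ (degree p - i) * coeff p i * (c * x) ^ i)"
    by (simp add: scale_roots_def poly_sum poly_monom)
  also have "\<dots> = (\<Sum>i\<le>degree p. c ^ degree p * (coeff p i * x ^ i))"
  proof (rule sum.cong[OF refl])
    fix i assume "i \<in> {..degree p}"
    then have "c ^ degree p = c ^ (degree p - i) * c ^ i" by (simp flip: power_add)
    then show "c ^ (degree p - i) * coeff p i * (c * x) ^ i = c ^ degree p * (coeff p i * x ^ i)"
      by (simp add: power_mult_distrib algebra_simps)
  qed
  finally show ?thesis by (simp add: poly_altdef sum_distrib_left)
qed

text \<open>The elementwise description of the Jacobson radical of a commutative ring, for a subring \<open>A\<close> of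
  a field.\<close>

definition in_jacobson_radical :: "'a::field set \<Rightarrow> 'a \<Rightarrow> bool" where
  "in_jacobson_radical A t \<longleftrightarrow>
     t \<in> A \<and> (\<forall>d\<in>A. 1 + t * d \<noteq> 0 \<and> inverse (1 + t * d) \<in> A)"

text \<open>If \<open>s\<close> is a root of a monic polynomial \<open>p\<close> over \<open>A\<close>, then \<open>t * s\<close> is a root of a monic
  polynomial whose lower coefficients are all divisible by \<open>t\<close>. Substituting \<open>X - 1\<close> gives a monic
  polynomial with root \<open>1 + t * s\<close> whose constant coefficient is, up to sign, of the form
  \<open>1 + t * d\<close> with \<open>d\<close> in \<open>A\<close>, hence a unit. So \<open>1 + t * s\<close> has an integral inverse.\<close>

lemma jacobson_radical_integral_closure:
  fixes A :: "'a::field set"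
  assumes A: "is_subring A" and t: "in_jacobson_radical A t"
  shows "in_jacobson_radical (integral_closure A) t"
proof -
  have tA: "t \<in> A" and unit: "\<And>d. d \<in> A \<Longrightarrow> 1 + t * d \<noteq> 0 \<and> inverse (1 + t * d) \<in> A"
    using t by (auto simp: in_jacobson_radical_def)
  have "1 + t * s \<noteq> 0 \<and> inverse (1 + t * s) \<in> integral_closure A"
    if "s \<in> integral_closure A" for s
  proof -
    obtain p where p: "lead_coeff p = 1" "p \<in> polys_over A" "poly p s = 0"
      using integral_closureE[OF \<open>s \<in> integral_closure A\<close>] .
    define n where "n = degree p"
    define S where "S = scale_roots t p"
    define q where "q = pcompose S [:-1, 1:]"
    have SA: "S \<in> polys_over A"
      using p(2) is_subringD[OF A] subring_power[OF A tA]
      by (auto simp: S_def polys_over_def coeff_scale_roots)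
    have qA: "q \<in> polys_over A"
      unfolding q_def using is_subringD[OF A]
      by (intro polys_over_pcompose[OF A SA]) (auto simp: polys_over_pCons_iff polys_over_0[OF A])
    have lq: "lead_coeff q = 1"
      unfolding q_def using lead_coeff_scale_roots[OF p(1)]
      by (subst lead_coeff_comp) (auto simp: S_def)
    have root: "poly q (1 + t * s) = 0"
      using p(3) by (simp add: q_def poly_pcompose S_def poly_scale_roots)
    define e where "e = (\<Sum>i<n. t ^ (n - Suc i) * coeff p i * (- 1) ^ i)"
    have eA: "e \<in> A" unfolding e_def
      using p(2) is_subringD[OF A] subring_power[OF A]
      by (intro subring_sum[OF A]) (auto simp: polys_over_def tA)
    \<comment> \<open>The leading term of \<open>S\<close> contributes the sign; every other coefficient is a multiple of \<open>t\<close>.\<close>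
    have "coeff q 0 = poly S (- 1)"
      by (simp add: q_def poly_pcompose flip: poly_0_coeff_0)
    also have "\<dots> = (\<Sum>i\<le>n. t ^ (n - i) * coeff p i * (- 1) ^ i)"
      using lead_coeff_scale_roots[OF p(1), of t]
      by (simp add: poly_altdef S_def coeff_scale_roots n_def)
    also have "\<dots> = (\<Sum>i<n. t ^ (n - i) * coeff p i * (- 1) ^ i) + (- 1) ^ n"
      using p(1) by (simp add: lessThan_Suc_atMost[symmetric] n_def)
    also have "(\<Sum>i<n. t ^ (n - i) * coeff p i * (- 1) ^ i) = t * e"
      unfolding e_def sum_distrib_left
      by (intro sum.cong refl) (simp add: Suc_diff_Suc flip: power_Suc mult.assoc)
    finally have c0: "coeff q 0 = (- 1) ^ n * (1 + t * ((- 1) ^ n * e))"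
      by (simp add: algebra_simps flip: power_mult_distrib)
    have m1: "(- 1) ^ n \<in> A" using is_subringD[OF A] by (intro subring_power[OF A]) auto
    have u: "1 + t * ((- 1) ^ n * e) \<noteq> 0 \<and> inverse (1 + t * ((- 1) ^ n * e)) \<in> A"
      using is_subringD[OF A] m1 eA by (intro unit) auto
    have "inverse (coeff q 0) = (- 1) ^ n * inverse (1 + t * ((- 1) ^ n * e))"
      by (simp add: c0 flip: power_inverse)
    then show ?thesis
      using u m1 is_subringD(3)[OF A] by (intro integral_inverse[OF A lq qA root]) (auto simp: c0)
  qed
  then show ?thesis
    using tA base_subset_integral_closure[OF A] by (auto simp: in_jacobson_radical_def)
qed

section \<open>Clearing denominators\<close>

text \<open>The localization \<open>A[1/t]\<close>, as a subset of the ambient field.\<close>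

definition localization_away :: "'a::field set \<Rightarrow> 'a \<Rightarrow> 'a set" where
  "localization_away A t = {x. \<exists>n. t ^ n * x \<in> A}"

text \<open>Make the polynomial of \<open>x\<close> monic and choose one power \<open>t ^ N\<close> that clears the denominators of
  all coefficients. Scaling the roots by \<open>t ^ N\<close> multiplies every coefficient below the leading one
  by a positive power of \<open>t ^ N\<close>, so the scaled polynomial has coefficients in \<open>A\<close>.\<close>

lemma algebraic_over_imp_scaled_integral:
  fixes A :: "'a::field set"
  assumes A: "is_subring A" and t: "t \<in> A"
    and F: "is_subfield (localization_away A t)"
    and x: "algebraic_over (localization_away A t) x"
  shows "\<exists>N. t ^ N * x \<in> integral_closure A"
proof -
  define F where "F = localization_away A t"
  obtain p where p: "\<And>i. coeff p i \<in> F" "p \<noteq> 0" "poly p x = 0"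
    using x by (auto simp: algebraic_over_def F_def)
  define q where "q = Polynomial.smult (inverse (lead_coeff p)) p"
  have lq: "lead_coeff q = 1" and q0: "poly q x = 0" using p by (auto simp: q_def)
  have qF: "coeff q i \<in> F" for i
    using F p(1) by (simp add: q_def is_subfield_def F_def)
  then obtain e where e: "\<And>i. t ^ e i * coeff q i \<in> A"
    unfolding F_def localization_away_def by auto metis
  \<comment> \<open>Any common upper bound of the exponents \<open>e i\<close> serves.\<close>
  define N where "N = (\<Sum>i\<le>degree q. e i)"
  have N: "t ^ N * coeff q i \<in> A" if "i \<le> degree q" for i
  proof -
    have "e i \<le> N" unfolding N_def using that by (intro member_le_sum) auto
    then have "t ^ N = t ^ (N - e i) * t ^ e i" by (simp flip: power_add)
    then have eq: "t ^ N * coeff q i = t ^ (N - e i) * (t ^ e i * coeff q i)"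
      by (simp only: mult.assoc)
    show ?thesis
      unfolding eq by (rule subring_mult[OF A subring_power[OF A t] e])
  qed
  have "t ^ N * x \<in> integral_closure A"
  proof (rule integral_closureI)
    show "lead_coeff (scale_roots (t ^ N) q) = 1" by (rule lead_coeff_scale_roots[OF lq])
    show "poly (scale_roots (t ^ N) q) (t ^ N * x) = 0" by (simp add: poly_scale_roots q0)
    have "(t ^ N) ^ (degree q - i) * coeff q i \<in> A" if "i \<le> degree q" for i
    proof (cases "i = degree q")
      case True
      then show ?thesis using lq is_subringD[OF A] by simp
    next
      case False
      then have "(t ^ N) ^ (degree q - i) = (t ^ N) ^ (degree q - Suc i) * t ^ N"
        using that by (simp add: Suc_diff_Suc flip: power_Suc2)
      then have eq: "(t ^ N) ^ (degree q - i) * coeff q i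
          = (t ^ N) ^ (degree q - Suc i) * (t ^ N * coeff q i)"
        by (simp only: mult.assoc)
      show ?thesis
        unfolding eq by (rule subring_mult[OF A subring_power[OF A subring_power[OF A t]] N[OF that]])
    qed
    then show "scale_roots (t ^ N) q \<in> polys_over A"
      using is_subringD[OF A] by (simp add: polys_over_def coeff_scale_roots)
  qed
  then show ?thesis ..
qed

section \<open>The local ring of $k[t]$ at $t = 0$\<close>

definition transcendental_over :: "'a::field set \<Rightarrow> 'a \<Rightarrow> bool" where
  "transcendental_over k t \<longleftrightarrow> (\<forall>p\<in>polys_over k. poly p t = 0 \<longrightarrow> p = 0)"

lemma local_ring_altdef:
  "local_ring k t = {poly f t / poly g t | f g. f \<in> polys_over k \<and> g \<in> polys_over k \<and> coeff g 0 \<noteq> 0}"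
  by (simp add: local_ring_def polys_over_def poly_0_coeff_0)

lemma local_ring_subring:
  assumes k: "is_subfield k" and t: "transcendental_over k t"
  shows "is_subring (local_ring k t)"
proof -
  note kp = is_subringD[OF polys_over_subring[OF subfield_imp_subring[OF k]]]
  have nz: "poly g t \<noteq> 0" if "g \<in> polys_over k" "coeff g 0 \<noteq> 0" for g
    using t that by (auto simp: transcendental_over_def)
  have "1 \<in> local_ring k t"
    unfolding local_ring_altdef using kp(1) by (auto intro!: exI[of _ 1])
  moreover have "x - y \<in> local_ring k t \<and> x * y \<in> local_ring k t"
    if xy: "x \<in> local_ring k t" "y \<in> local_ring k t" for x y
  proof -
    obtain f g where x: "x = poly f t / poly g t" "f \<in> polys_over k" "g \<in> polys_over k" "coeff g 0 \<noteq> 0"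
      using xy(1) unfolding local_ring_altdef by auto
    obtain f' g' where y: "y = poly f' t / poly g' t" "f' \<in> polys_over k" "g' \<in> polys_over k" "coeff g' 0 \<noteq> 0"
      using xy(2) unfolding local_ring_altdef by auto
    have "x - y = poly (f * g' - f' * g) t / poly (g * g') t"
      using nz[OF x(3,4)] nz[OF y(3,4)] by (simp add: x(1) y(1) diff_frac_eq mult.commute)
    moreover have "x * y = poly (f * f') t / poly (g * g') t"
      by (simp add: x y)
    moreover have "coeff (g * g') 0 \<noteq> 0" using x y by (simp add: coeff_mult)
    ultimately show ?thesis
      unfolding local_ring_altdef using x y kp by blast
  qed
  ultimately show ?thesis by (simp add: is_subring_def)
qed

lemma coefficients_subset_local_ring:
  assumes k: "is_subfield k"
  shows "k \<subseteq> local_ring k t"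
proof
  fix c assume "c \<in> k"
  then show "c \<in> local_ring k t"
    unfolding local_ring_altdef
    using is_subringD[OF polys_over_subring[OF subfield_imp_subring[OF k]]]
    by (intro CollectI exI[of _ "[:c:]"] exI[of _ 1]) (auto simp: polys_over_pCons_iff)
qed

text \<open>If \<open>d = f(t) / g(t)\<close>, then \<open>1 + t * d = (g + X * f)(t) / g(t)\<close>, and \<open>g + X * f\<close> has the same
  nonzero constant coefficient as \<open>g\<close>.\<close>

lemma local_ring_jacobson:
  assumes k: "is_subfield k" and t: "transcendental_over k t"
  shows "in_jacobson_radical (local_ring k t) t"
proof -
  note kr = is_subringD[OF subfield_imp_subring[OF k]]
  note kp = is_subringD[OF polys_over_subring[OF subfield_imp_subring[OF k]]]
  have nz: "poly g t \<noteq> 0" if "g \<in> polys_over k" "coeff g 0 \<noteq> 0" for g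
    using t that by (auto simp: transcendental_over_def)
  have X: "[:0, 1:] \<in> polys_over k" using kr kp by (simp add: polys_over_pCons_iff)
  then have "t \<in> local_ring k t"
    unfolding local_ring_altdef using kp(1) by (intro CollectI exI[of _ "[:0, 1:]"] exI[of _ 1]) auto
  moreover have "1 + t * d \<noteq> 0 \<and> inverse (1 + t * d) \<in> local_ring k t" if dD: "d \<in> local_ring k t" for d
  proof -
    obtain f g where d: "d = poly f t / poly g t" "f \<in> polys_over k" "g \<in> polys_over k" "coeff g 0 \<noteq> 0"
      using dD unfolding local_ring_altdef by auto
    define h where "h = g + [:0, 1:] * f"
    have h: "h \<in> polys_over k" "coeff h 0 \<noteq> 0"
      using d X kp(3,6) unfolding h_def by (blast, simp add: coeff_mult)
    have "1 + t * d = poly h t / poly g t"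
      using nz[OF d(3,4)] by (simp add: d h_def field_simps)
    then show ?thesis
      unfolding local_ring_altdef using nz[OF h] nz[OF d(3,4)] h d by auto
  qed
  ultimately show ?thesis by (simp add: in_jacobson_radical_def)
qed

text \<open>Inverting \<open>t\<close> already gives a field: a nonzero \<open>f\<close> is \<open>X ^ m * h\<close> with \<open>h\<close> of nonzero
  constant coefficient, so the inverse of \<open>f(t) / g(t)\<close> is \<open>g(t) / h(t)\<close> divided by \<open>t ^ m\<close>.\<close>

lemma local_ring_fraction_field:
  assumes k: "is_subfield k" and t: "transcendental_over k t" and t0: "t \<noteq> 0"
  shows "is_subfield (localization_away (local_ring k t) t)"
proof -
  define D where "D = local_ring k t"
  have D: "is_subring D" unfolding D_def by (rule local_ring_subring[OF k t])
  have tD: "t \<in> D" using local_ring_jacobson[OF k t] by (simp add: D_def in_jacobson_radical_def)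
  note Dr = is_subringD[OF D] subring_power[OF D]
  have diff_mult: "x - y \<in> localization_away D t \<and> x * y \<in> localization_away D t"
    if xy: "x \<in> localization_away D t" "y \<in> localization_away D t" for x y
  proof -
    obtain n m where nm: "t ^ n * x \<in> D" "t ^ m * y \<in> D"
      using xy by (auto simp: localization_away_def)
    have "t ^ (n + m) * (x - y) = t ^ m * (t ^ n * x) - t ^ n * (t ^ m * y)"
      by (simp add: power_add algebra_simps)
    moreover have "t ^ (n + m) * (x * y) = (t ^ n * x) * (t ^ m * y)"
      by (simp add: power_add algebra_simps)
    ultimately show ?thesis
      unfolding localization_away_def using nm Dr tD by (metis (mono_tags, lifting) mem_Collect_eq)
  qed
  have inv: "inverse x \<in> localization_away D t" if x: "x \<in> localization_away D t" "x \<noteq> 0" for x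
  proof -
    obtain n where n: "t ^ n * x \<in> D" using x by (auto simp: localization_away_def)
    obtain f g where d: "t ^ n * x = poly f t / poly g t" "f \<in> polys_over k" "g \<in> polys_over k" "coeff g 0 \<noteq> 0"
      using n unfolding D_def local_ring_altdef by auto
    have "f \<noteq> 0" using d(1) x t0 by auto
    define m where "m = order 0 f"
    obtain h where h: "f = [:- 0, 1:] ^ m * h" "\<not> [:- 0, 1:] dvd h"
      using order_decomp[OF \<open>f \<noteq> 0\<close>, of 0] unfolding m_def by auto
    have fm: "f = monom 1 m * h" using h(1) by (simp add: monom_altdef)
    have h0: "coeff h 0 \<noteq> 0" using h(2) by (simp add: dvd_iff_poly_eq_0 poly_0_coeff_0)
    have "coeff h i = coeff f (i + m)" for i by (simp add: fm coeff_monom_mult)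
    then have hk: "h \<in> polys_over k" using d(2) by (simp add: polys_over_def)
    have "t ^ m * inverse x = t ^ n * (t ^ m * inverse (t ^ n * x))"
      using t0 by simp
    also have "t ^ m * inverse (t ^ n * x) = poly g t / poly h t"
      unfolding d(1) fm using t0 by (simp add: poly_monom)
    also have "t ^ n * (poly g t / poly h t) \<in> D"
    proof (rule Dr(3))
      show "poly g t / poly h t \<in> D" using hk h0 d by (auto simp: D_def local_ring_altdef)
    qed (rule Dr(7)[OF tD])
    finally show ?thesis by (auto simp: localization_away_def)
  qed
  have "0 \<in> localization_away D t" "1 \<in> localization_away D t"
    unfolding localization_away_def using Dr by (auto intro!: exI[of _ 0])
  then show ?thesis
    unfolding is_subfield_def D_def[symmetric] using diff_mult inv by (metis inverse_zero)
qed

section \<open>Transcendence from algebraic independence\<close>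

lemma adjoin_subfield: "is_subfield (adjoin K S)"
  unfolding adjoin_def by (rule hull_in) (auto simp: is_subfield_def)

lemma adjoin_generators: "K \<union> S \<subseteq> adjoin K S"
  unfolding adjoin_def by (rule hull_subset)

lemma adjoin_minimal: "is_subfield F \<Longrightarrow> K \<subseteq> F \<Longrightarrow> S \<subseteq> F \<Longrightarrow> adjoin K S \<subseteq> F"
  unfolding adjoin_def by (rule hull_minimal) auto

definition mpolys_over :: "'a::field set \<Rightarrow> 'a set \<Rightarrow> (('a \<Rightarrow>\<^sub>0 nat) \<Rightarrow>\<^sub>0 'a) set" where
  "mpolys_over K S = {p. (\<forall>m. Poly_Mapping.lookup p m \<in> K) \<and>
     (\<forall>m\<in>Poly_Mapping.keys p. Poly_Mapping.keys m \<subseteq> S)}"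

definition eval_monom :: "('a::comm_ring_1 \<Rightarrow>\<^sub>0 nat) \<Rightarrow> 'a" where
  "eval_monom m = (\<Prod>b\<in>Poly_Mapping.keys m. b ^ Poly_Mapping.lookup m b)"

lemma eval_monom_superset:
  assumes "finite S" "Poly_Mapping.keys m \<subseteq> S"
  shows "eval_monom m = (\<Prod>b\<in>S. b ^ Poly_Mapping.lookup m b)"
  unfolding eval_monom_def using assms by (intro prod.mono_neutral_left) (auto simp: in_keys_iff)

lemma eval_monom_0 [simp]: "eval_monom 0 = 1"
  by (simp add: eval_monom_def)

lemma eval_monom_single [simp]: "eval_monom (Poly_Mapping.single b n) = b ^ n"
  by (simp add: eval_monom_def)

lemma eval_monom_add: "eval_monom (m + m') = eval_monom m * eval_monom m'"
proof -
  let ?S = "Poly_Mapping.keys m \<union> Poly_Mapping.keys m'"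
  have "eval_monom (m + m') = (\<Prod>b\<in>?S. b ^ Poly_Mapping.lookup (m + m') b)"
    using keys_add[of m m'] by (intro eval_monom_superset) auto
  also have "\<dots> = (\<Prod>b\<in>?S. b ^ Poly_Mapping.lookup m b) * (\<Prod>b\<in>?S. b ^ Poly_Mapping.lookup m' b)"
    by (simp add: lookup_add power_add prod.distrib)
  finally show ?thesis by (simp add: eval_monom_superset[of ?S])
qed

lemma eval_mpoly_altdef:
  "eval_mpoly p = (\<Sum>m\<in>Poly_Mapping.keys p. Poly_Mapping.lookup p m * eval_monom m)"
  by (simp add: eval_mpoly_def eval_monom_def)

lemma eval_mpoly_superset:
  assumes "finite S" "Poly_Mapping.keys p \<subseteq> S"
  shows "eval_mpoly p = (\<Sum>m\<in>S. Poly_Mapping.lookup p m * eval_monom m)"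
  unfolding eval_mpoly_altdef using assms by (intro sum.mono_neutral_left) (auto simp: in_keys_iff)

lemma eval_mpoly_0 [simp]: "eval_mpoly 0 = 0"
  by (simp add: eval_mpoly_def)

lemma eval_mpoly_single [simp]: "eval_mpoly (Poly_Mapping.single m c) = c * eval_monom m"
  by (simp add: eval_mpoly_altdef)

lemma eval_mpoly_add: "eval_mpoly (p + q) = eval_mpoly p + eval_mpoly q"
proof -
  let ?S = "Poly_Mapping.keys p \<union> Poly_Mapping.keys q"
  have "eval_mpoly (p + q) = (\<Sum>m\<in>?S. Poly_Mapping.lookup (p + q) m * eval_monom m)"
    using keys_add[of p q] by (intro eval_mpoly_superset) auto
  also have "\<dots> = (\<Sum>m\<in>?S. Poly_Mapping.lookup p m * eval_monom m)
      + (\<Sum>m\<in>?S. Poly_Mapping.lookup q m * eval_monom m)"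
    by (simp add: lookup_add distrib_right sum.distrib)
  finally show ?thesis by (simp add: eval_mpoly_superset[of ?S])
qed

lemma eval_mpoly_sum: "eval_mpoly (\<Sum>i\<in>I. f i) = (\<Sum>i\<in>I. eval_mpoly (f i))"
  by (induction I rule: infinite_finite_induct) (auto simp: eval_mpoly_add)

context
  fixes K S :: "'a::field set"
  assumes K: "is_subfield K"
begin

private lemmas Kr = is_subringD[OF subfield_imp_subring[OF K]]

lemma mpolys_over_add:
  assumes "p \<in> mpolys_over K S" "q \<in> mpolys_over K S"
  shows "p + q \<in> mpolys_over K S"
  using assms keys_add[of p q] Kr by (fastforce simp: mpolys_over_def lookup_add)

lemma mpolys_over_single:
  assumes "c \<in> K" "Poly_Mapping.keys m \<subseteq> S"
  shows "Poly_Mapping.single m c \<in> mpolys_over K S"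
  using assms Kr by (auto simp: mpolys_over_def lookup_single when_def split: if_splits)

lemma mpolys_over_sum:
  assumes "\<And>i. i \<in> I \<Longrightarrow> f i \<in> mpolys_over K S"
  shows "(\<Sum>i\<in>I. f i) \<in> mpolys_over K S"
  using assms
proof (induction I rule: infinite_finite_induct)
  case (insert x F)
  then show ?case by (auto intro!: mpolys_over_add)
qed (use Kr in \<open>auto simp: mpolys_over_def\<close>)

text \<open>The ring \<open>K[S]\<close> is realized by the values of the polynomials over \<open>K\<close> in the indeterminates
  from \<open>S\<close>.\<close>

lemma mpoly_values_subring: "is_subring (eval_mpoly ` mpolys_over K S)"
proof -
  let ?R = "eval_mpoly ` mpolys_over K S"
  have mult: "x * y \<in> ?R" if xy: "x \<in> ?R" "y \<in> ?R" for x y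
  proof -
    obtain p q where p: "x = eval_mpoly p" "p \<in> mpolys_over K S"
      and q: "y = eval_mpoly q" "q \<in> mpolys_over K S"
      using xy by auto
    define s where "s = (\<Sum>m\<in>Poly_Mapping.keys p. \<Sum>m'\<in>Poly_Mapping.keys q.
      Poly_Mapping.single (m + m') (Poly_Mapping.lookup p m * Poly_Mapping.lookup q m'))"
    have "eval_mpoly s = x * y"
      unfolding p q s_def eval_mpoly_sum eval_mpoly_single eval_monom_add
      by (simp add: eval_mpoly_altdef sum_product mult_ac)
    moreover have "s \<in> mpolys_over K S" unfolding s_def
    proof (intro mpolys_over_sum mpolys_over_single)
      fix m m' assume "m \<in> Poly_Mapping.keys p" "m' \<in> Poly_Mapping.keys q"
      then show "Poly_Mapping.keys (m + m') \<subseteq> S"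
        using p(2) q(2) keys_add[of m m'] by (fastforce simp: mpolys_over_def)
    qed (use p q Kr in \<open>auto simp: mpolys_over_def\<close>)
    ultimately show ?thesis by (metis image_eqI)
  qed
  have const: "c \<in> ?R" if "c \<in> K" for c
    using mpolys_over_single[OF that, of 0] by (auto intro!: image_eqI[of _ _ "Poly_Mapping.single 0 c"])
  have add: "x + y \<in> ?R" if "x \<in> ?R" "y \<in> ?R" for x y
    using that mpolys_over_add by (auto simp flip: eval_mpoly_add)
  have "x - y \<in> ?R" if "x \<in> ?R" "y \<in> ?R" for x y
    using add[OF that(1) mult[OF const[of "- 1"] that(2)]] Kr by simp
  then show ?thesis using mult const Kr by (simp add: is_subring_def)
qed

lemma mpoly_values_generators: "K \<union> S \<subseteq> eval_mpoly ` mpolys_over K S"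
proof
  fix c assume "c \<in> K \<union> S"
  then show "c \<in> eval_mpoly ` mpolys_over K S"
  proof
    assume "c \<in> K"
    then show ?thesis using mpolys_over_single[of c 0]
      by (auto intro!: image_eqI[of _ _ "Poly_Mapping.single 0 c"])
  next
    assume "c \<in> S"
    then show ?thesis using mpolys_over_single[of 1 "Poly_Mapping.single c 1"] Kr
      by (auto intro!: image_eqI[of _ _ "Poly_Mapping.single (Poly_Mapping.single c 1) 1"])
  qed
qed

end

lemma fractions_subfield:
  fixes R :: "'a::field set"
  assumes R: "is_subring R"
  shows "is_subfield {a / b | a b. a \<in> R \<and> b \<in> R \<and> b \<noteq> 0}" (is "is_subfield ?Q")
proof -
  note Rr = is_subringD[OF R]
  have Q: "a / b \<in> ?Q" if "a \<in> R" "b \<in> R" "b \<noteq> 0" for a b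
    using that by blast
  have RQ: "a \<in> ?Q" if "a \<in> R" for a using Q[OF that Rr(1)] by simp
  have "x - y \<in> ?Q \<and> x * y \<in> ?Q" if xy: "x \<in> ?Q" "y \<in> ?Q" for x y
  proof -
    obtain a b where x: "x = a / b" "a \<in> R" "b \<in> R" "b \<noteq> 0" using xy(1) by blast
    obtain c d where y: "y = c / d" "c \<in> R" "d \<in> R" "d \<noteq> 0" using xy(2) by blast
    have "x - y = (a * d - c * b) / (b * d)" "x * y = (a * c) / (b * d)" "b * d \<noteq> 0"
      using x(1,4) y(1,4) by (auto simp: field_simps)
    then show ?thesis
      using Q[OF Rr(2)[OF Rr(3)[OF x(2) y(3)] Rr(3)[OF y(2) x(3)]] Rr(3)[OF x(3) y(3)]]
        Q[OF Rr(3)[OF x(2) y(2)] Rr(3)[OF x(3) y(3)]] by simp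
  qed
  moreover have "inverse x \<in> ?Q" if xQ: "x \<in> ?Q" for x
  proof -
    obtain a b where x: "x = a / b" "a \<in> R" "b \<in> R" "b \<noteq> 0" using xQ by blast
    show ?thesis
      using Q[OF x(3,2)] RQ[OF Rr(4)] by (cases "a = 0") (simp_all add: x(1))
  qed
  ultimately show ?thesis unfolding is_subfield_def using RQ[OF Rr(1)] RQ[OF Rr(4)] by blast
qed

lemma adjoin_subset_fractions:
  fixes K S :: "'a::field set"
  assumes K: "is_subfield K"
  defines "R \<equiv> eval_mpoly ` mpolys_over K S"
  shows "adjoin K S \<subseteq> {a / b | a b. a \<in> R \<and> b \<in> R \<and> b \<noteq> 0}"
proof -
  have R: "is_subring R" unfolding R_def by (rule mpoly_values_subring[OF K])
  have "a \<in> {a / b | a b. a \<in> R \<and> b \<in> R \<and> b \<noteq> 0}" if "a \<in> R" for a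
    using that subring_one[OF R] by (intro CollectI exI[of _ a] exI[of _ 1]) auto
  then show ?thesis
    using mpoly_values_generators[OF K, of S, folded R_def]
    by (intro adjoin_minimal fractions_subfield[OF R]) auto
qed

lemma common_denominator:
  fixes R :: "'a::field set"
  assumes R: "is_subring R" and p: "p \<in> polys_over {a / b | a b. a \<in> R \<and> b \<in> R \<and> b \<noteq> 0}"
  shows "\<exists>d\<in>R. d \<noteq> 0 \<and> Polynomial.smult d p \<in> polys_over R"
  using p
proof (induction p)
  case 0
  then show ?case using is_subringD[OF R] by (auto simp: polys_over_0[OF R] intro!: bexI[of _ 1])
next
  case (pCons c p)
  then obtain d where d: "d \<in> R" "d \<noteq> 0" "Polynomial.smult d p \<in> polys_over R"
    by (auto simp: polys_over_pCons_iff)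
  obtain a b where c: "c = a / b" "a \<in> R" "b \<in> R" "b \<noteq> 0"
    using pCons.prems by (auto simp: polys_over_pCons_iff)
  have "Polynomial.smult (d * b) p \<in> polys_over R"
    using d(3) c(3) is_subringD[OF R]
    by (auto simp: polys_over_def mult.assoc mult.left_commute[of d b])
  moreover have "d * b * c \<in> R" using c d is_subringD[OF R] by simp
  ultimately show ?case using c d is_subringD[OF R]
    by (intro bexI[of _ "d * b"]) (auto simp: polys_over_pCons_iff)
qed

text \<open>After multiplication by a common denominator, the coefficients of \<open>p\<close> are values of
  multivariate polynomials \<open>q i\<close> in which the indeterminate of \<open>b\<close> does not occur. Then \<open>p(b)\<close> is
  up to a factor the value of \<open>P = (\<Sum>i. q i * X\<^sub>b ^ i)\<close>. Algebraic independence gives \<open>P = 0\<close>, and as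
  the terms of different \<open>i\<close> have different exponents at \<open>b\<close>, all \<open>q i\<close> vanish.\<close>

theorem algebraically_independent_imp_transcendental:
  fixes K B :: "'a::field set"
  assumes K: "is_subfield K" and B: "algebraically_independent K B" "b \<in> B"
    and p: "p \<in> polys_over (adjoin K (B - {b}))" "poly p b = 0"
  shows "p = 0"
proof -
  define S where "S = B - {b}"
  define R where "R = eval_mpoly ` mpolys_over K S"
  have R: "is_subring R" unfolding R_def by (rule mpoly_values_subring[OF K])
  have "p \<in> polys_over {a / b | a b. a \<in> R \<and> b \<in> R \<and> b \<noteq> 0}"
    using p(1) adjoin_subset_fractions[OF K, of S] unfolding polys_over_def R_def S_def by blast
  then obtain d where d: "d \<in> R" "d \<noteq> 0" "Polynomial.smult d p \<in> polys_over R"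
    using common_denominator[OF R] by blast
  have "\<exists>q\<in>mpolys_over K S. coeff (Polynomial.smult d p) i = eval_mpoly q" for i
    using d(3) by (auto simp: polys_over_def R_def)
  then obtain q where q: "\<And>i. q i \<in> mpolys_over K S" "\<And>i. coeff (Polynomial.smult d p) i = eval_mpoly (q i)"
    by metis
  define n where "n = degree (Polynomial.smult d p)"
  \<comment> \<open>The sum of \<open>q i * X\<^sub>b ^ i\<close>, written out in monomials: multiplication by \<open>X\<^sub>b ^ i\<close> adds
    \<open>single b i\<close> to each exponent vector.\<close>
  define P where "P = (\<Sum>i\<le>n. \<Sum>m\<in>Poly_Mapping.keys (q i).
    Poly_Mapping.single (m + Poly_Mapping.single b i) (Poly_Mapping.lookup (q i) m))"
  have "eval_mpoly P = (\<Sum>i\<le>n. eval_mpoly (q i) * b ^ i)"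
    unfolding P_def eval_mpoly_sum eval_mpoly_single eval_monom_add eval_monom_single
    by (simp add: eval_mpoly_altdef sum_distrib_right mult.assoc)
  also have "\<dots> = poly (Polynomial.smult d p) b" by (simp add: poly_altdef n_def flip: q(2))
  finally have "eval_mpoly P = 0" using p(2) by simp
  moreover have "P \<in> mpolys_over K B" unfolding P_def
  proof (intro mpolys_over_sum[OF K] mpolys_over_single[OF K])
    fix i m assume "m \<in> Poly_Mapping.keys (q i)"
    then have "Poly_Mapping.keys m \<subseteq> B" using q(1)[of i] by (auto simp: mpolys_over_def S_def)
    then show "Poly_Mapping.keys (m + Poly_Mapping.single b i) \<subseteq> B"
      using keys_add[of m "Poly_Mapping.single b i"] B(2) by (auto split: if_splits)
  qed (use q(1) in \<open>auto simp: mpolys_over_def\<close>)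
  ultimately have P0: "P = 0"
    using B(1) by (auto simp: algebraically_independent_def mpolys_over_def)
  have no_b: "Poly_Mapping.lookup m b = 0" if "m \<in> Poly_Mapping.keys (q i)" for i m
    using that q(1)[of i] by (auto simp: mpolys_over_def S_def simp flip: not_in_keys_iff_lookup_eq_zero)
  have "q j = 0" if j: "j \<le> n" for j
  proof (rule ccontr)
    assume "q j \<noteq> 0"
    then obtain m0 where m0: "m0 \<in> Poly_Mapping.keys (q j)" by fastforce
    have key: "m + Poly_Mapping.single b i = m0 + Poly_Mapping.single b j \<longleftrightarrow> i = j \<and> m = m0"
      if "m \<in> Poly_Mapping.keys (q i)" for i m
    proof
      assume eq: "m + Poly_Mapping.single b i = m0 + Poly_Mapping.single b j"
      have "i = j"
        using arg_cong[OF eq, of "\<lambda>m. Poly_Mapping.lookup m b"] no_b[OF that] no_b[OF m0]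
        by (simp add: lookup_add)
      then show "i = j \<and> m = m0" using eq by simp
    qed auto
    have "Poly_Mapping.lookup P (m0 + Poly_Mapping.single b j) =
      (\<Sum>i\<le>n. \<Sum>m\<in>Poly_Mapping.keys (q i). if i = j \<and> m = m0 then Poly_Mapping.lookup (q i) m else 0)"
      unfolding P_def lookup_sum by (intro sum.cong refl) (simp add: lookup_single when_def key)
    also have "\<dots> = (\<Sum>i\<le>n. if i = j then Poly_Mapping.lookup (q j) m0 else 0)"
      using m0 by (intro sum.cong refl) auto
    also have "\<dots> = Poly_Mapping.lookup (q j) m0" using j by simp
    finally show False using P0 m0 by (simp add: in_keys_iff)
  qed
  then have "coeff (Polynomial.smult d p) j = 0" if "j \<le> n" for j using q(2) that by simp
  then have "lead_coeff (Polynomial.smult d p) = 0" unfolding n_def by blast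
  then show ?thesis using d(2) by simp
qed

section \<open>The field as a localization of the integral closure\<close>

lemma transcendental_inverse:
  assumes "transcendental_over k b" "is_subring k" "b \<noteq> 0"
  shows "transcendental_over k (inverse b)"
  unfolding transcendental_over_def
proof (intro ballI impI)
  fix p assume p: "p \<in> polys_over k" "poly p (inverse b) = 0"
  then have "poly (reflect_poly p) b = 0" using assms(3) by (simp add: poly_reflect_poly_nz)
  then show "p = 0"
    using assms(1) polys_over_reflect[OF assms(2) p(1)] by (auto simp: transcendental_over_def)
qed

text \<open>The field \<open>D[1/t]\<close>, with \<open>D\<close> the local ring and \<open>t\<close> the inverse of \<open>b\<close>, contains \<open>k\<close> and \<open>b\<close>,
  hence all of \<open>adjoin K B\<close>. So every element of the ambient field is algebraic over it.\<close>

theorem scaled_integral_over_local_ring: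
  fixes B :: "'a::field set"
  assumes K: "is_subfield K" and B: "transcendence_basis K B" "b \<in> B" and b0: "b \<noteq> 0"
  defines "k \<equiv> adjoin K (B - {b})"
  shows "transcendental_over k (inverse b)"
    and "\<exists>N. inverse b ^ N * x \<in> integral_closure (local_ring k (inverse b))"
proof -
  have k: "is_subfield k" unfolding k_def by (rule adjoin_subfield)
  have "transcendental_over k b"
    using algebraically_independent_imp_transcendental[OF K _ B(2)] B(1)
    unfolding transcendental_over_def transcendence_basis_def k_def by blast
  then show tr: "transcendental_over k (inverse b)"
    by (rule transcendental_inverse[OF _ subfield_imp_subring[OF k] b0])
  define t where "t = inverse b"
  define D where "D = local_ring k t"
  define F where "F = localization_away D t"
  have t0: "t \<noteq> 0" using b0 by (simp add: t_def)
  have D: "is_subring D" unfolding D_def t_def by (rule local_ring_subring[OF k tr])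
  have tD: "t \<in> D" unfolding D_def t_def
    using local_ring_jacobson[OF k tr] by (simp add: in_jacobson_radical_def)
  have F: "is_subfield F"
    unfolding F_def D_def using local_ring_fraction_field[OF k tr] t0 by (simp add: t_def)
  have "D \<subseteq> F" unfolding F_def localization_away_def by (auto intro: exI[of _ 0])
  then have kF: "k \<subseteq> F" unfolding D_def using coefficients_subset_local_ring[OF k] by blast
  have "t ^ 1 * b \<in> D" using b0 subring_one[OF D] by (simp add: t_def)
  then have "b \<in> F" unfolding F_def localization_away_def by blast
  then have "adjoin K B \<subseteq> F"
    using kF adjoin_generators[of K "B - {b}", folded k_def] by (intro adjoin_minimal F) auto
  then have "algebraic_over F x"
    using B(1) unfolding transcendence_basis_def algebraic_over_def by blast
  then show "\<exists>N. inverse b ^ N * x \<in> integral_closure (local_ring k (inverse b))"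
    using algebraic_over_imp_scaled_integral[OF D tD] F by (simp add: F_def D_def t_def)
qed

section \<open>Ring orders from positive cones\<close>

lemma positive_cone_ring_order:
  assumes P: "positive_cone P"
  shows "ring_order (cone_le P)"
proof -
  have add: "x + y \<in> P" and mult: "x * y \<in> P" if "x \<in> P" "y \<in> P" for x y
    using P that by (auto simp: positive_cone_def)
  have sym: "P \<inter> uminus ` P = {0}" using P by (simp add: positive_cone_def)
  then have zero: "0 \<in> P" by blast
  have anti: "x = 0" if "x \<in> P" "- x \<in> P" for x
  proof -
    have "x \<in> uminus ` P" using that(2) by (intro image_eqI[of _ _ "- x"]) auto
    then show ?thesis using sym that(1) by blast
  qed
  have "transp (cone_le P)"
  proof (rule transpI)
    fix x y z assume "cone_le P x y" "cone_le P y z"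
    then show "cone_le P x z" using add[of "y - x" "z - y"] by (simp add: cone_le_def)
  qed
  moreover have "antisymp (cone_le P)"
  proof (rule antisympI)
    fix x y assume "cone_le P x y" "cone_le P y x"
    then show "x = y" using anti[of "y - x"] by (simp add: cone_le_def)
  qed
  moreover have "reflp (cone_le P)" by (auto simp: reflp_def cone_le_def zero)
  moreover have "\<forall>x y z. cone_le P x y \<longrightarrow> cone_le P (x + z) (y + z)" by (simp add: cone_le_def)
  moreover have "\<forall>x y. cone_le P 0 x \<longrightarrow> cone_le P 0 y \<longrightarrow> cone_le P 0 (x * y)"
    using mult by (simp add: cone_le_def)
  ultimately show ?thesis unfolding ring_order_def by blast
qed

lemma positive_cone_directed:
  assumes P: "positive_cone P" and dom: "\<And>z. \<exists>u\<in>P. u + z \<in> P"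
  shows "directed_order (cone_le P)"
proof -
  have add: "\<And>x y. x \<in> P \<Longrightarrow> y \<in> P \<Longrightarrow> x + y \<in> P" using P by (simp add: positive_cone_def)
  have upper: "\<exists>u. u + x \<in> P \<and> u + y \<in> P" for x y
  proof -
    obtain u v where "u \<in> P" "u + x \<in> P" "v \<in> P" "v + y \<in> P" using dom by metis
    then show ?thesis using add[of "u + x" v] add[of "v + y" u]
      by (intro exI[of _ "u + v"]) (simp add: algebra_simps)
  qed
  have "\<exists>u. cone_le P x u \<and> cone_le P y u" for x y
    using upper[of "- x" "- y"] by (simp add: cone_le_def)
  moreover have "\<exists>l. cone_le P l x \<and> cone_le P l y" for x y
  proof -
    obtain u where "u + x \<in> P" "u + y \<in> P" using upper by blast
    then show ?thesis by (intro exI[of _ "- u"]) (simp add: cone_le_def add.commute)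
  qed
  ultimately show ?thesis by (simp add: directed_order_def)
qed

section \<open>Cones of elements with positive leading term\<close>

text \<open>The set \<open>A\<close> plays the role of the positive leading coefficients; \<open>t\<close> is an infinitesimal.\<close>

locale infinitesimal_cone =
  fixes R :: "'a::field set" and t :: 'a and A :: "'a set"
  assumes R: "is_subring R" and radical: "in_jacobson_radical R t" and t_nonzero: "t \<noteq> 0"
    and A_subset: "A \<subseteq> R" and A_one: "1 \<in> A" and A_zero: "0 \<notin> A"
    and A_add: "\<And>a b. a \<in> A \<Longrightarrow> b \<in> A \<Longrightarrow> a + b \<in> A"
    and A_mult: "\<And>a b. a \<in> A \<Longrightarrow> b \<in> A \<Longrightarrow> a * b \<in> A"
    and A_inverse: "\<And>a. a \<in> A \<Longrightarrow> inverse a \<in> A"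
begin

definition cone :: "'a set" where
  "cone = {0} \<union> (\<Union>n::int. {t powi (- n) * (a + t * r) | a r. a \<in> A \<and> r \<in> R})"

text \<open>The elements of \<open>R\<close> whose residue modulo \<open>t\<close> is represented in \<open>A\<close>: the nonzero elements of
  the cone are their products with powers of \<open>t\<close>.\<close>

definition positive_units :: "'a set" where
  "positive_units = {a + t * r | a r. a \<in> A \<and> r \<in> R}"

lemmas R_closed = is_subringD[OF R] subring_power[OF R]

lemma t_in_R: "t \<in> R"
  using radical by (simp add: in_jacobson_radical_def)

lemma unit_near_one: "r \<in> R \<Longrightarrow> 1 + t * r \<noteq> 0 \<and> inverse (1 + t * r) \<in> R"
  using radical by (simp add: in_jacobson_radical_def)

lemma positive_units_subset: "positive_units \<subseteq> R"
proof
  fix u assume "u \<in> positive_units"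
  then obtain a r where u: "u = a + t * r" "a \<in> A" "r \<in> R" by (auto simp: positive_units_def)
  show "u \<in> R"
    unfolding u(1) using u(2) A_subset by (intro R_closed(6) R_closed(3) t_in_R u(3)) auto
qed

lemma positive_units_A: "A \<subseteq> positive_units"
proof
  fix a assume "a \<in> A"
  moreover have "a = a + t * 0" by simp
  ultimately show "a \<in> positive_units" unfolding positive_units_def using R_closed(4) by blast
qed

lemma positive_units_perturb:
  assumes "u \<in> positive_units" "r \<in> R"
  shows "u + t * r \<in> positive_units"
proof -
  obtain a s where u: "u = a + t * s" "a \<in> A" "s \<in> R" using assms by (auto simp: positive_units_def)
  have "u + t * r = a + t * (s + r)" by (simp add: u algebra_simps)
  then show ?thesis unfolding positive_units_def using u(2) R_closed(6)[OF u(3) assms(2)] by blast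
qed

lemma positive_units_add:
  assumes "u \<in> positive_units" "v \<in> positive_units"
  shows "u + v \<in> positive_units"
proof -
  obtain a r where u: "u = a + t * r" "a \<in> A" "r \<in> R" using assms by (auto simp: positive_units_def)
  obtain b s where v: "v = b + t * s" "b \<in> A" "s \<in> R" using assms by (auto simp: positive_units_def)
  have "u + v = (a + b) + t * (r + s)" by (simp add: u v algebra_simps)
  then show ?thesis unfolding positive_units_def using A_add[OF u(2) v(2)] R_closed(6)[OF u(3) v(3)] by blast
qed

lemma positive_units_mult:
  assumes "u \<in> positive_units" "v \<in> positive_units"
  shows "u * v \<in> positive_units"
proof -
  obtain a r where u: "u = a + t * r" "a \<in> A" "r \<in> R" using assms by (auto simp: positive_units_def)
  obtain b s where v: "v = b + t * s" "b \<in> A" "s \<in> R" using assms by (auto simp: positive_units_def)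
  have "u * v = a * b + t * (a * s + r * v)" by (simp add: u v algebra_simps)
  moreover have "a * s + r * v \<in> R"
    using u(2,3) v(3) assms(2) A_subset positive_units_subset
    by (intro R_closed(6) R_closed(3)) auto
  ultimately show ?thesis unfolding positive_units_def using A_mult[OF u(2) v(2)] by blast
qed

text \<open>Factor \<open>a + t * r = a * (1 + t * s)\<close> with \<open>s = r / a\<close>. The second factor is a unit, and its
  inverse \<open>w\<close> is \<open>1 - t * (s * w)\<close>, again congruent to \<open>1\<close> modulo \<open>t\<close>.\<close>

lemma positive_units_inverse:
  assumes "u \<in> positive_units"
  shows "u \<noteq> 0" "inverse u \<in> positive_units"
proof -
  obtain a r where u: "u = a + t * r" "a \<in> A" "r \<in> R" using assms by (auto simp: positive_units_def)
  have a0: "a \<noteq> 0" using u A_zero by auto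
  have ia: "inverse a \<in> A" using u A_inverse by auto
  define s where "s = inverse a * r"
  have sR: "s \<in> R" unfolding s_def using ia A_subset u(3) by (intro R_closed(3)) auto
  define w where "w = inverse (1 + t * s)"
  have w: "1 + t * s \<noteq> 0" "w \<in> R" using unit_near_one[OF sR] by (auto simp: w_def)
  have ua: "u = a * (1 + t * s)" using a0 by (simp add: u s_def algebra_simps)
  show "u \<noteq> 0" using ua a0 w by simp
  have "inverse u = inverse a * w" by (simp add: ua w_def)
  also have "w = 1 + t * (- s * w)"
  proof -
    have "(1 + t * s) * w = 1" unfolding w_def using w(1) by (rule right_inverse)
    then show ?thesis by (simp add: distrib_right algebra_simps)
  qed
  also have "inverse a * (1 + t * (- s * w)) = inverse a + t * (inverse a * (- s * w))"
    by (simp add: algebra_simps)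
  also have "\<dots> \<in> positive_units"
  proof -
    have "inverse a * (- s * w) \<in> R"
      using ia A_subset sR w(2) by (intro R_closed(3) R_closed(5)) auto
    then show ?thesis unfolding positive_units_def using ia by blast
  qed
  finally show "inverse u \<in> positive_units" .
qed

lemma cone_altdef: "cone = {0} \<union> {t powi n * u | n u. u \<in> positive_units}"
proof -
  have "(\<Union>n::int. {t powi (- n) * (a + t * r) | a r. a \<in> A \<and> r \<in> R})
      = {t powi n * u | n u. u \<in> positive_units}" (is "?L = ?M")
  proof (intro equalityI subsetI)
    fix x assume "x \<in> ?L"
    then obtain n :: int and a r where x: "x = t powi (- n) * (a + t * r)" "a \<in> A" "r \<in> R"
      by blast
    have "a + t * r \<in> positive_units" unfolding positive_units_def using x(2,3) by blast
    then show "x \<in> ?M" using x(1) by blast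
  next
    fix x assume "x \<in> ?M"
    then obtain n u where x: "x = t powi n * u" "u \<in> positive_units" by blast
    then obtain a r where u: "u = a + t * r" "a \<in> A" "r \<in> R"
      unfolding positive_units_def by blast
    have "x = t powi (- (- n)) * (a + t * r)" by (simp only: x(1) u(1) minus_minus)
    then show "x \<in> ?L" using u(2,3) by blast
  qed
  then show ?thesis unfolding cone_def by (rule arg_cong)
qed

lemma cone_zero: "0 \<in> cone"
  unfolding cone_altdef by blast

lemma coneI: "u \<in> positive_units \<Longrightarrow> t powi n * u \<in> cone"
  unfolding cone_altdef by blast

lemma nonzero_coneE:
  assumes "x \<in> cone" "x \<noteq> 0"
  obtains n u where "x = t powi n * u" "u \<in> positive_units"
  using assms unfolding cone_altdef by blast

lemma powi_mult_nonzero: "u \<in> positive_units \<Longrightarrow> t powi n * u \<noteq> 0"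
  using positive_units_inverse(1) t_nonzero by simp

text \<open>The summand with the larger power of \<open>t\<close> is a perturbation from \<open>tR\<close> of the other one.\<close>

lemma positive_units_add_shifted:
  assumes uv: "u \<in> positive_units" "v \<in> positive_units" and "n \<le> m"
  shows "\<exists>w\<in>positive_units. t powi n * u + t powi m * v = t powi n * w"
proof (cases "n = m")
  case True
  then show ?thesis
    using positive_units_add[OF uv] by (auto simp: distrib_left intro!: bexI[of _ "u + v"])
next
  case False
  \<comment> \<open>One factor \<open>t\<close> of \<open>t powi (m - n)\<close> is split off to exhibit the perturbation as a multiple of \<open>t\<close>.\<close>
  define k where "k = nat (m - n - 1)"
  have m: "m = n + 1 + int k" using False assms(3) by (simp add: k_def)
  have "t powi m = t powi n * (t * t ^ k)"
    using t_nonzero unfolding m by (simp add: power_int_add)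
  then have "t powi n * u + t powi m * v = t powi n * (u + t * (t ^ k * v))"
    by (simp add: algebra_simps)
  moreover have "t ^ k * v \<in> R" using uv(2) positive_units_subset by (intro R_closed(3,7) t_in_R) auto
  ultimately show ?thesis using positive_units_perturb[OF uv(1)] by blast
qed

lemma nonzero_cone_add:
  assumes x: "x \<in> cone" "x \<noteq> 0" and y: "y \<in> cone" "y \<noteq> 0"
  shows "x + y \<in> cone \<and> x + y \<noteq> 0"
proof -
  obtain n u where x: "x = t powi n * u" "u \<in> positive_units" using nonzero_coneE[OF x] .
  obtain m v where y: "y = t powi m * v" "v \<in> positive_units" using nonzero_coneE[OF y] .
  have "\<exists>w\<in>positive_units. \<exists>l. x + y = t powi l * w"
  proof (cases "n \<le> m")
    case True
    then show ?thesis using positive_units_add_shifted[OF x(2) y(2) True] by (auto simp: x y)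
  next
    case False
    then have "m \<le> n" by simp
    then show ?thesis using positive_units_add_shifted[OF y(2) x(2)] by (force simp: x y add.commute)
  qed
  then obtain w l where "w \<in> positive_units" "x + y = t powi l * w" by blast
  then show ?thesis using coneI[of w l] powi_mult_nonzero[of w l] by simp
qed

lemma cone_mult:
  assumes "x \<in> cone" "y \<in> cone"
  shows "x * y \<in> cone"
proof (cases "x = 0 \<or> y = 0")
  case True
  then show ?thesis by (auto simp: cone_def)
next
  case False
  obtain n u where x: "x = t powi n * u" "u \<in> positive_units" using nonzero_coneE assms False by metis
  obtain m v where y: "y = t powi m * v" "v \<in> positive_units" using nonzero_coneE assms False by metis
  have "x * y = t powi (n + m) * (u * v)" using t_nonzero by (simp add: x y power_int_add)
  then show ?thesis using coneI[OF positive_units_mult[OF x(2) y(2)]] by simp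
qed

lemma cone_add: "x \<in> cone \<Longrightarrow> y \<in> cone \<Longrightarrow> x + y \<in> cone"
  using nonzero_cone_add[of x y] by (cases "x = 0"; cases "y = 0") auto

theorem positive_cone: "positive_cone cone"
proof -
  have "x = 0" if "x \<in> cone" "- x \<in> cone" for x
    using nonzero_cone_add[of x "- x"] that by auto
  then have "cone \<inter> uminus ` cone = {0}" using cone_zero by force
  then show ?thesis unfolding positive_cone_def using cone_add cone_mult by blast
qed

theorem cone_inverse:
  assumes "x \<in> cone" "x \<noteq> 0"
  shows "inverse x \<in> cone"
proof -
  obtain n u where x: "x = t powi n * u" "u \<in> positive_units" using nonzero_coneE[OF assms] .
  have "inverse x = t powi (- n) * inverse u" by (simp add: x power_int_minus)
  then show ?thesis using coneI[OF positive_units_inverse(2)[OF x(2)]] by simp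
qed

lemma cone_one: "1 \<in> cone"
  using coneI[of 1 0] positive_units_A A_one by auto

theorem cone_dominates:
  assumes z: "t ^ N * z \<in> R"
  shows "inverse t ^ Suc N + z \<in> cone - {0}"
proof -
  have "inverse t ^ Suc N + z = t powi (- int (Suc N)) * (1 + t * (t ^ N * z))"
  proof -
    have "inverse t ^ Suc N * t ^ Suc N = 1"
      by (metis t_nonzero left_inverse power_mult_distrib power_one)
    moreover have "t powi (- int (Suc N)) = inverse t ^ Suc N"
      by (simp only: power_int_minus power_int_of_nat power_inverse)
    moreover have "t * (t ^ N * z) = t ^ Suc N * z" by simp
    ultimately show ?thesis by (simp only: distrib_left mult_1_right mult_1_left flip: mult.assoc)
  qed
  moreover have "1 + t * (t ^ N * z) \<in> positive_units"
    using z A_one by (auto simp: positive_units_def)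
  ultimately show ?thesis using coneI powi_mult_nonzero by (metis DiffI singletonD)
qed

text \<open>Nonzero elements of \<open>L\<close> are units of \<open>R\<close> and therefore not multiples of \<open>t\<close>, as \<open>t\<close> is in the
  Jacobson radical. An element \<open>x = t powi n * (a + t * r)\<close> of \<open>L\<close> with \<open>n \<noteq> 0\<close> would make \<open>x\<close> or \<open>a\<close>
  a multiple of \<open>t\<close>; for \<open>n = 0\<close> the difference \<open>x - a\<close> is one.\<close>

theorem cone_Int_subfield:
  assumes L: "is_subfield L" "L \<subseteq> R" "A \<subseteq> L"
  shows "cone \<inter> L = {0} \<union> A"
proof -
  note Lr = is_subringD[OF subfield_imp_subring[OF L(1)]]
  have no_t: "x = 0" if "x \<in> L" "x = t * r" "r \<in> R" for x r
  proof (rule ccontr)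
    assume "x \<noteq> 0"
    have "inverse x \<in> R" using L that(1) by (auto simp: is_subfield_def)
    then have "1 + t * (- r * inverse x) \<noteq> 0" using that(3) \<open>inverse x \<in> R\<close>
      by (intro unit_near_one[THEN conjunct1] R_closed(3) R_closed(5))
    moreover have "t * (- r * inverse x) = - 1" using that \<open>x \<noteq> 0\<close> by (simp add: field_simps)
    ultimately show False by simp
  qed
  have "x \<in> A" if x: "x \<in> cone" "x \<in> L" "x \<noteq> 0" for x
  proof -
    obtain n u where nu: "x = t powi n * u" "u \<in> positive_units" using nonzero_coneE x by metis
    obtain a r where u: "u = a + t * r" "a \<in> A" "r \<in> R" using nu by (auto simp: positive_units_def)
    have xR: "x \<in> R" and aL: "a \<in> L" using x L u by auto
    consider "n < 0" | "n = 0" | "n > 0" by linarith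
    then show ?thesis
    proof cases
      case 1
      define k where "k = nat (- n - 1)"
      have n: "n = - (1 + int k)" using 1 by (simp add: k_def)
      have "t powi (1 + int k) * t powi n = 1"
        using t_nonzero by (simp add: n flip: power_int_add)
      then have "u = t powi (1 + int k) * x" by (simp add: nu(1) flip: mult.assoc)
      also have "\<dots> = t * (t ^ k * x)" using t_nonzero by (simp add: power_int_add)
      finally have "a = t * (t ^ k * x - r)" by (simp add: u algebra_simps)
      then have "a = 0" by (rule no_t[OF aL]) (intro R_closed(2,3,7) t_in_R xR u(3))
      then show ?thesis using u A_zero by simp
    next
      case 2
      then have "x - a = t * r" by (simp add: nu u)
      then have "x - a = 0" by (rule no_t[OF Lr(2)[OF x(2) aL]]) (rule u(3))
      then show ?thesis using u by simp
    next
      case 3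
      define k where "k = nat (n - 1)"
      have n: "n = 1 + int k" using 3 by (simp add: k_def)
      have "x = t * (t ^ k * u)" using t_nonzero by (simp add: nu(1) n power_int_add)
      then have "x = 0"
        by (rule no_t[OF x(2)]) (use nu(2) positive_units_subset in \<open>intro R_closed(3,7) t_in_R; auto\<close>)
      then show ?thesis using x by simp
    qed
  qed
  moreover have "A \<subseteq> cone" using coneI[of _ 0] positive_units_A by auto
  ultimately show ?thesis using L(3) Lr(4) cone_zero by blast
qed

end

section \<open>Real and complex algebraic numbers\<close>

text \<open>As the rational numbers form a field, algebraic and integral over them is the same; thus the
  general result on integral closures also shows that the algebraic numbers form a ring.\<close>

lemma Qbar_eq_integral_closure: "Qbar = integral_closure \<rat>"
proof
  show "integral_closure \<rat> \<subseteq> Qbar"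
    by (auto simp: Qbar_def integral_closure_def algebraic_altdef)
  show "Qbar \<subseteq> integral_closure \<rat>"
  proof
    fix z assume "z \<in> Qbar"
    then obtain p where p: "\<And>i. coeff p i \<in> \<rat>" "p \<noteq> 0" "poly p z = 0"
      by (auto simp: Qbar_def algebraic_altdef)
    then show "z \<in> integral_closure \<rat>"
      by (intro integral_closureI[of "Polynomial.smult (inverse (lead_coeff p)) p"])
        (auto simp: polys_over_def)
  qed
qed

lemma Rats_subfield: "is_subfield (\<rat> :: 'a::field_char_0 set)"
  by (auto simp: is_subfield_def)

lemma Qbar_subfield: "is_subfield Qbar"
proof -
  have "is_subring Qbar"
    unfolding Qbar_eq_integral_closure
    by (intro integral_closure_subring subfield_imp_subring Rats_subfield)
  then show ?thesis
    using subring_zero[of Qbar] by (auto simp: is_subfield_def is_subring_def) (auto simp: Qbar_def)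
qed

lemma real_algebraic_pos_closed:
  assumes "a \<in> real_algebraic_pos" "b \<in> real_algebraic_pos"
  shows "a + b \<in> real_algebraic_pos" "a * b \<in> real_algebraic_pos" "inverse a \<in> real_algebraic_pos"
proof -
  note Qr = is_subringD[OF subfield_imp_subring[OF Qbar_subfield]]
  obtain x y where xy: "a = complex_of_real x" "b = complex_of_real y" "x > 0" "y > 0"
    using assms by (auto simp: real_algebraic_pos_def)
  have "inverse a \<in> Qbar" using assms Qbar_subfield by (auto simp: real_algebraic_pos_def is_subfield_def)
  moreover have "a + b \<in> Qbar" "a * b \<in> Qbar" using assms Qr by (auto simp: real_algebraic_pos_def)
  moreover have "a + b = complex_of_real (x + y)" "a * b = complex_of_real (x * y)"
    "inverse a = complex_of_real (inverse x)" by (auto simp: xy)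
  ultimately show "a + b \<in> real_algebraic_pos" "a * b \<in> real_algebraic_pos"
    "inverse a \<in> real_algebraic_pos"
    using xy(3,4) by (auto simp: real_algebraic_pos_def simp del: of_real_add of_real_mult of_real_inverse)
qed

lemma real_algebraic_nonneg_eq: "real_algebraic_nonneg = {0} \<union> real_algebraic_pos"
proof -
  have "0 \<in> Qbar" by (simp add: Qbar_def)
  moreover have "{0..} = insert 0 {0::real<..}" by auto
  ultimately show ?thesis by (auto simp: real_algebraic_nonneg_def real_algebraic_pos_def)
qed

section \<open>The order on the complex numbers\<close>

lemma is_subring_of_real_image: "is_subring D \<Longrightarrow> is_subring (complex_of_real ` D)"
  unfolding is_subring_def by (auto simp flip: of_real_diff of_real_mult intro: image_eqI[of _ _ 1])

lemma in_jacobson_radical_of_real_image: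
  assumes "in_jacobson_radical D t"
  shows "in_jacobson_radical (complex_of_real ` D) (complex_of_real t)"
  unfolding in_jacobson_radical_def
proof (intro conjI ballI)
  show "complex_of_real t \<in> complex_of_real ` D"
    using assms by (simp add: in_jacobson_radical_def)
  fix d assume "d \<in> complex_of_real ` D"
  then obtain x where x: "d = complex_of_real x" "x \<in> D" by blast
  have eq: "1 + complex_of_real t * d = complex_of_real (1 + t * x)" by (simp add: x)
  have "1 + t * x \<noteq> 0 \<and> inverse (1 + t * x) \<in> D"
    using assms x(2) by (simp add: in_jacobson_radical_def)
  then show "1 + complex_of_real t * d \<noteq> 0" "inverse (1 + complex_of_real t * d) \<in> complex_of_real ` D"
    unfolding eq of_real_inverse[symmetric] of_real_eq_0_iff by (blast intro: imageI)+
qed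

lemma integral_closure_of_real:
  assumes "x \<in> integral_closure D"
  shows "complex_of_real x \<in> integral_closure (complex_of_real ` D)"
proof -
  obtain p where p: "lead_coeff p = 1" "p \<in> polys_over D" "poly p x = 0"
    using integral_closureE[OF assms] .
  show ?thesis
  proof (rule integral_closureI)
    show "lead_coeff (map_poly complex_of_real p) = 1" using p by simp
    show "map_poly complex_of_real p \<in> polys_over (complex_of_real ` D)"
      using p by (simp add: polys_over_def coeff_map_poly)
    show "poly (map_poly complex_of_real p) (complex_of_real x) = 0"
      using p by simp
  qed
qed

theorem theorem1p1:
  fixes B :: "real set" and t :: real and k D :: "real set" and \<O> P :: "complex set"
  assumes "transcendence_basis \<rat> B" and "pi \<in> B"
    and "t = inverse pi"
    and "k = adjoin \<rat> (B - {pi})"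
    and "D = local_ring k t"
    and "\<O> = integral_closure (complex_of_real ` D)"
    and "P = {0} \<union> (\<Union>n::int. {complex_of_real t powi (- n) * (a + complex_of_real t * r) | a r.
                 a \<in> real_algebraic_pos \<and> r \<in> \<O>})"
  shows "positive_cone P \<and> ring_order (cone_le P) \<and> directed_order (cone_le P) \<and>
    1 \<in> P \<and> (\<forall>x\<in>P. x \<noteq> 0 \<longrightarrow> inverse x \<in> P) \<and>
    (\<forall>z. \<exists>N::nat. N \<ge> 1 \<and> complex_of_real pi ^ N + z \<in> P - {0}
                        \<and> complex_of_real pi ^ N - z \<in> P - {0}) \<and>
    P \<inter> Qbar = real_algebraic_nonneg"
proof -
  let ?t = "complex_of_real t"
  note basis = scaled_integral_over_local_ring[OF Rats_subfield assms(1,2) pi_neq_zero,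
      folded assms(3,4), folded assms(5)]
  have t0: "?t \<noteq> 0" by (simp add: assms(3))
  have k: "is_subfield k" unfolding assms(4) by (rule adjoin_subfield)
  have D: "is_subring D" unfolding assms(5) by (rule local_ring_subring[OF k basis(1)])
  have DC: "is_subring (complex_of_real ` D)" by (rule is_subring_of_real_image[OF D])
  have rad: "in_jacobson_radical D t" unfolding assms(5) by (rule local_ring_jacobson[OF k basis(1)])
  have O: "is_subring \<O>" unfolding assms(6) by (rule integral_closure_subring[OF DC])
  have radO: "in_jacobson_radical \<O> ?t"
    unfolding assms(6)
    by (rule jacobson_radical_integral_closure[OF DC in_jacobson_radical_of_real_image[OF rad]])
  have "\<rat> \<subseteq> complex_of_real ` D"
  proof
    fix c :: complex assume "c \<in> \<rat>"
    then obtain q where "c = of_rat q" by (auto elim: Rats_cases)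
    then have c: "c = complex_of_real (of_rat q)" by (cases q) (simp add: of_rat_rat)
    have "of_rat q \<in> D"
      using Rats_of_rat[of q] adjoin_generators[of \<rat> "B - {pi}"]
        coefficients_subset_local_ring[OF k, of t]
      unfolding assms(4,5) by blast
    then show "c \<in> complex_of_real ` D" unfolding c by (rule imageI)
  qed
  then have QO: "Qbar \<subseteq> \<O>"
    unfolding Qbar_eq_integral_closure assms(6) by (rule integral_closure_mono)
  interpret infinitesimal_cone \<O> ?t real_algebraic_pos
  proof
    show "real_algebraic_pos \<subseteq> \<O>" using QO by (auto simp: real_algebraic_pos_def)
    show "1 \<in> real_algebraic_pos"
      using is_subringD(1)[OF subfield_imp_subring[OF Qbar_subfield]]
      by (auto simp: real_algebraic_pos_def intro!: image_eqI[of _ _ 1])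
    show "0 \<notin> real_algebraic_pos" by (auto simp: real_algebraic_pos_def)
  qed (use O radO t0 real_algebraic_pos_closed in auto)
  have P: "P = cone" unfolding assms(7) cone_def ..
  have scaled: "\<exists>N. ?t ^ N * z \<in> \<O>" for z
  proof -
    \<comment> \<open>Algebraicity over the field generated by the basis is known for real numbers, so the real and
      the imaginary part are scaled separately.\<close>
    obtain n m where nm: "t ^ n * Re z \<in> integral_closure D" "t ^ m * Im z \<in> integral_closure D"
      using basis(2) by metis
    have nmO: "complex_of_real (t ^ n * Re z) \<in> \<O>" "complex_of_real (t ^ m * Im z) \<in> \<O>"
      unfolding assms(6) by (intro integral_closure_of_real nm)+
    have "\<i> \<in> \<O>" using QO by (auto simp: Qbar_def)
    have "?t ^ (n + m) * z = ?t ^ m * complex_of_real (t ^ n * Re z)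
        + ?t ^ n * (\<i> * complex_of_real (t ^ m * Im z))"
      by (subst complex_eq[of z]) (simp add: power_add algebra_simps)
    also have "\<dots> \<in> \<O>"
      by (intro R_closed(6) R_closed(3) R_closed(7) nmO t_in_R \<open>\<i> \<in> \<O>\<close>)
    finally show ?thesis ..
  qed
  have inv_t: "inverse ?t = complex_of_real pi" by (simp add: assms(3))
  have dom: "\<exists>N::nat. N \<ge> 1 \<and> complex_of_real pi ^ N + z \<in> P - {0}
      \<and> complex_of_real pi ^ N - z \<in> P - {0}" for z
  proof -
    obtain N where N: "?t ^ N * z \<in> \<O>" using scaled by blast
    then have "?t ^ N * (- z) \<in> \<O>" using R_closed(5) by simp
    then show ?thesis
      using cone_dominates[OF N] cone_dominates[of N "- z"] unfolding P inv_t
      by (intro exI[of _ "Suc N"]) simp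
  qed
  have "\<exists>u\<in>P. u + z \<in> P" for z
  proof -
    obtain N where "complex_of_real pi ^ N + z \<in> P" using dom by blast
    moreover have "?t powi (- int N) * 1 \<in> P"
      unfolding P using positive_units_A A_one by (intro coneI) auto
    moreover have "?t powi (- int N) = complex_of_real pi ^ N"
      by (simp only: power_int_minus power_int_of_nat power_inverse[symmetric] inv_t)
    ultimately show ?thesis by auto
  qed
  then have "directed_order (cone_le P)"
    unfolding P by (intro positive_cone_directed positive_cone) auto
  moreover have "ring_order (cone_le P)"
    unfolding P by (rule positive_cone_ring_order[OF positive_cone])
  moreover have "P \<inter> Qbar = real_algebraic_nonneg"
    unfolding P real_algebraic_nonneg_eq
    by (rule cone_Int_subfield[OF Qbar_subfield QO]) (auto simp: real_algebraic_pos_def)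
  ultimately show ?thesis
    using positive_cone cone_one cone_inverse dom unfolding P by blast
qed

end
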